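(* Let $L$ be a $(p,q)$-leaper with $p+q$ odd, $C$ a cycle of $L$ within a $(p+q)\times(p+q)$ chessboard, $M$ the canonical second leaper associated with $C$, and $D$ the canonical second leaper cycle of $M$ over the squares of $C$. Then $D$ is the leaper graph of $M$ over the squares of $C$ (that is, two squares of $C$ are joined by a move of $M$ if and only if they are consecutive in $D$).
   Context: Leapers. A square is a unit square of the infinite chessboard. A $(p,q)$-leaper is a piece that moves from a square $a$ to any of $a+(\pm p,\pm q)$, $a+(\pm q,\pm p)$; a $(p,q)$-leaper and a $(q,p)$-leaper are the same. The leaper graph of $L$ over a set of squares $B$ has the squares of $B$ as vertices, two being adjacent when a move of $L$ joins them; a cycle of $L$ within $B$ is a simple cycle in this graph. The leaper is basic if $p+q$ is odd and $\gcd(p,q)=1$, and skew if $p,q$ are nonzero and distinct. Frames. Let $m<n$ be coprime positive integers with $m+n$ odd. Identify squares with their centers, the centers being the points of $\mathbb Z^2$. The $(m,n)$-frame $F$ is the set of squares $(x,y)$ with $\frac{n-m}2<\max(|x|,|y|)<\frac{m+n}2$, i.e. an $(m+n)\times(m+n)$ board with an $(n-m)\times(n-m)$ central hole. Its section $F_{\mathtt E}$ consists of the squares with $\frac{n-m}2<x<\frac{m+n}2$, $|y|<\frac{n-m}2$; its section $F_{\mathtt{NE}}$ of those with $\frac{n-m}2<x,y<\frac{m+n}2$; the sections $F_{\mathtt N},F_{\mathtt{NW}},F_{\mathtt W},F_{\mathtt{SW}},F_{\mathtt S},F_{\mathtt{SE}}$ are obtained by counterclockwise rotations by multiples of $90^\circ$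 about the origin. In the leaper graph of the $(m,n)$-leaper over the $(m+n)\times(m+n)$ board the squares of the hole are isolated and all squares of $F$ have degree two, so a cycle is determined by its vertex set. Lifting. The lifting transformations $\mathtt f,\mathtt g,\mathtt h$ take $S\subseteq F$ to the disjoint union of $(S+v_i)\cap H_i$ over the eight directions $i$, where $H$ is respectively the $(m,2m+n)$-, $(n,2n-m)$-, $(n,m+2n)$-frame, and for $\mathtt f$: $v_{\mathtt E}=(m+n,0)$, $v_{\mathtt{NE}}=(m,m)$; for $\mathtt g$: $v_{\mathtt E}=(n-m,0)$, $v_{\mathtt{NE}}=(n,n)$; for $\mathtt h$: $v_{\mathtt E}=(m+n,0)$, $v_{\mathtt{NE}}=(n,n)$; the other $v_i$ are obtained by $90^\circ$ rotations. Each maps the vertex set of a cycle of the $(m,n)$-leaper within $F$ to the vertex set of a cycle of the leaper with the proportions of $H$ within $H$; this defines the lift of a cycle. Shell. Let $n\le3m$. If $2m\ge n$, the shell of $F$ is the union of eight $(n-m)\times(n-m)$ subboards: the four corners of $F$ and the four adjacent by side to the central hole. If $2m\le n\le3m$, it is the union of eight $(3m-n)\times(3m-n)$ subboards: one in the middle of each outer side and four adjacent by corner to the central hole. (When $n=2m$ both give all of $F$.) The shell is a union of eight-square cycles of the $(m,n)$-leaper, called shell cycles; each visits exactly one square in each section. Canonical second leaper and cycle, basic case. Let $L$ be a skew basic $(p,q)$-leaper, $p<q$. Its descent is the unique string $e_1\ldots e_l$ of characters $\mathtt f,\mathtt g,\mathtt h$ such that successively applying lifting transformations of types $e_l,\ldots,e_1$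 to a $(1,2)$-frame gives a $(p,q)$-frame. For a cycle $C$ of $L$ within a $(p+q)\times(p+q)$ board there is a unique $j$ such that $C$ is obtained, by successively applying lifting transformations of types $e_j,\ldots,e_1$, from a shell cycle $C'$ of the frame $F'$ whose leaper has descent $e_{j+1}\ldots e_l$; either $j=l$ and $F'$ is a $(1,2)$-frame, or $j<l$ and $e_{j+1}\in\{\mathtt g,\mathtt h\}$. The canonical second leaper $M$ associated with $C$ is the $(0,1)$-leaper if $j=l$, and the skew basic leaper of descent $e_{j+2}\ldots e_l$ if $j<l$. The canonical second leaper cycle over the squares of $C'$ is the cycle of $M$ visiting the eight squares of $C'$ in the order of their sections $\mathtt E,\mathtt{NE},\mathtt N,\mathtt{NW},\mathtt W,\mathtt{SW},\mathtt S,\mathtt{SE}$, written as a concatenation $a_0a_1\ldots a_7$ of eight one-square paths. Number the directions $\mathtt E,\mathtt{NE},\ldots,\mathtt{SE}$ by $0,\ldots,7$ modulo $8$, let $u_0=(1,0)$, $u_1=(1,1)$, $u_2=(0,1)$, $u_3=(-1,1)$, $u_{i+4}=-u_i$, and let $-w$ be the path $w$ traversed backwards. A cycle $a_0a_1\ldots a_7$ of $M$ within an $(m,n)$-frame, split into eight paths with $a_i$ in the section of direction $i$, is lifted to $b_0b_1\ldots b_7$ within the larger frame by the rules: $\mathtt f$: $b_i=(-a_{i+5})(-a_{i+4})(-a_{i+3})+(m+n)u_i$ for $i$ even, $b_i=a_i+mu_i$ for $i$ odd; $\mathtt g$: $b_i=a_i+(n-m)u_i$ for $i$ even, $b_i=(-a_{i+5})(-a_{i+4})(-a_{i+3})+nu_i$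 for $i$ odd; $\mathtt h$: $b_i=(-a_{i+6})(-a_{i+5})(-a_{i+4})(-a_{i+3})(-a_{i+2})+(m+n)u_i$ for $i$ even, $b_i=a_{i-1}a_ia_{i+1}+nu_i$ for $i$ odd. The canonical second leaper cycle $D$ over the squares of $C$ is obtained from the one over the squares of $C'$ by successively applying the lifts of types $e_j,\ldots,e_1$; it is a Hamiltonian cycle of $M$ over the squares of $C$. General case. If $p+q$ is odd and $d=\gcd(p,q)$, every cycle $C$ of a $(p,q)$-leaper within a $(p+q)\times(p+q)$ board is a copy, scaled by a factor of $d$ (on the centers of the squares), of a cycle $\tilde C$ of the basic $(p/d,q/d)$-leaper within a $\frac{p+q}d\times\frac{p+q}d$ board; the canonical second leaper of $C$ and the canonical second leaper cycle over its squares are those of $\tilde C$ scaled by the same factor $d$ (an $(r,s)$-leaper becoming a $(dr,ds)$-leaper). *)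

theory Defs
  imports "HOL-Library.Product_Plus"
begin

type_synonym square = "int \<times> int"
type_synonym leaper = "nat \<times> nat"

text \<open>A graph is a pair of a vertex set and a set of two-element edges.\<close>
type_synonym graph = "square set \<times> square set set"


section \<open>Leapers and their cycles\<close>

definition leaper_move :: "leaper \<Rightarrow> square \<Rightarrow> square \<Rightarrow> bool" where
  "leaper_move L a b \<longleftrightarrow>
     (\<bar>fst b - fst a\<bar> = int (fst L) \<and> \<bar>snd b - snd a\<bar> = int (snd L)) \<or>
     (\<bar>fst b - fst a\<bar> = int (snd L) \<and> \<bar>snd b - snd a\<bar> = int (fst L))"

definition leaper_graph :: "leaper \<Rightarrow> square set \<Rightarrow> graph" where
  "leaper_graph L B = (B, {{a, b} | a b. a \<in> B \<and> b \<in> B \<and> leaper_move L a b})"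

text \<open>A cycle is given by the list of its squares in a cyclic order; the last square is
  consecutive with the first.\<close>
definition cycle_graph :: "square list \<Rightarrow> graph" where
  "cycle_graph c = (set c, {{c ! i, c ! (Suc i mod length c)} | i. i < length c})"

definition leaper_cycle :: "leaper \<Rightarrow> square set \<Rightarrow> square list \<Rightarrow> bool" where
  "leaper_cycle L B c \<longleftrightarrow>
     3 \<le> length c \<and> distinct c \<and> set c \<subseteq> B \<and>
     snd (cycle_graph c) \<subseteq> snd (leaper_graph L B)"

definition board :: "square \<Rightarrow> nat \<Rightarrow> square set" where
  "board z k = {fst z ..< fst z + int k} \<times> {snd z ..< snd z + int k}"

text \<open>The board of odd side \<open>k\<close> centered at the origin.\<close>
definition centered_board :: "nat \<Rightarrow> square set" where
  "centered_board k = {(x, y). 2 * \<bar>x\<bar> < int k \<and> 2 * \<bar>y\<bar> < int k}"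


section \<open>Frames and their sections\<close>

definition quarter_turn :: "square \<Rightarrow> square" where
  "quarter_turn z = (- snd z, fst z)"

text \<open>Directions E, NE, N, NW, W, SW, S, SE are numbered \<open>0, \<dots>, 7\<close>. A frame is referred to by
  the proportions \<open>(m, n)\<close>, \<open>m < n\<close>, of its leaper. All inequalities between
  half-integers are doubled.\<close>
fun frame_section :: "leaper \<Rightarrow> nat \<Rightarrow> square set" where
  "frame_section (m, n) i = (quarter_turn ^^ (i div 2)) `
     (if even i
      then {(x, y). int n - int m < 2 * x \<and> 2 * x < int m + int n \<and> 2 * \<bar>y\<bar> < int n - int m}
      else {(x, y). int n - int m < 2 * x \<and> 2 * x < int m + int n \<and>
                    int n - int m < 2 * y \<and> 2 * y < int m + int n})"

definition direction :: "nat \<Rightarrow> square" where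
  "direction i = (quarter_turn ^^ (i div 2)) (if even i then (1, 0) else (1, 1))"

text \<open>For \<open>n \<le> 2 m\<close>, the corner of the frame and the subboard adjacent by side to the hole, both
  of side \<open>n - m\<close>; for \<open>2 m \<le> n \<le> 3 m\<close>, the subboard in the middle of an outer side and the
  subboard adjacent by corner to the hole, both of side \<open>3 m - n\<close>. Only meaningful
  for \<open>n \<le> 3 m\<close>.\<close>
fun shell :: "leaper \<Rightarrow> square set" where
  "shell (m, n) = (\<Union>k<4. (quarter_turn ^^ k) `
     (if n \<le> 2 * m
      then {(x, y). 3 * int m - int n < 2 * x \<and> 2 * x < int m + int n \<and>
                    3 * int m - int n < 2 * y \<and> 2 * y < int m + int n}
         \<union> {(x, y). int n - int m < 2 * x \<and> 2 * x < 3 * (int n - int m) \<and>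
                    2 * \<bar>y\<bar> < int n - int m}
      else {(x, y). 3 * int n - 5 * int m < 2 * x \<and> 2 * x < int m + int n \<and>
                    2 * \<bar>y\<bar> < 3 * int m - int n}
         \<union> {(x, y). int n - int m < 2 * x \<and> 2 * x < 5 * int m - int n \<and>
                    int n - int m < 2 * y \<and> 2 * y < 5 * int m - int n}))"

definition shell_cycle :: "leaper \<Rightarrow> square list \<Rightarrow> bool" where
  "shell_cycle L c \<longleftrightarrow>
     snd L \<le> 3 * fst L \<and> leaper_cycle L (shell L) c \<and> length c = 8"


section \<open>Lifting\<close>

datatype lift_type = F | G | H

fun lift_leaper :: "lift_type \<Rightarrow> leaper \<Rightarrow> leaper" where
  "lift_leaper F (m, n) = (m, 2 * m + n)"
| "lift_leaper G (m, n) = (n, 2 * n - m)"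
| "lift_leaper H (m, n) = (n, m + 2 * n)"

text \<open>The skew basic leaper whose descent is the given string.\<close>
definition leaper_of_descent :: "lift_type list \<Rightarrow> leaper" where
  "leaper_of_descent es = foldr lift_leaper es (1, 2)"

text \<open>The translation vector \<open>v\<^sub>i\<close>; it is a multiple of the direction vector \<open>u\<^sub>i\<close>.\<close>
fun lift_vector :: "lift_type \<Rightarrow> leaper \<Rightarrow> nat \<Rightarrow> square" where
  "lift_vector e (m, n) i =
     (let k = (case e of
                 F \<Rightarrow> if even i then int m + int n else int m
               | G \<Rightarrow> if even i then int n - int m else int n
               | H \<Rightarrow> if even i then int m + int n else int n)
      in (k * fst (direction i), k * snd (direction i)))"

definition lift_set :: "lift_type \<Rightarrow> leaper \<Rightarrow> square set \<Rightarrow> square set" where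
  "lift_set e L S =
     (\<Union>i<8. (\<lambda>z. z + lift_vector e L i) ` S \<inter> frame_section (lift_leaper e L) i)"

text \<open>A cycle split into eight paths is given by the function from the directions \<open>0, \<dots>, 7\<close>
  to these paths.\<close>
fun lift_pieces :: "lift_type \<Rightarrow> (nat \<Rightarrow> square list) \<Rightarrow> nat \<Rightarrow> square list" where
  "lift_pieces F a i =
     (if even i then rev (a ((i + 5) mod 8)) @ rev (a ((i + 4) mod 8)) @ rev (a ((i + 3) mod 8))
      else a i)"
| "lift_pieces G a i =
     (if even i then a i
      else rev (a ((i + 5) mod 8)) @ rev (a ((i + 4) mod 8)) @ rev (a ((i + 3) mod 8)))"
| "lift_pieces H a i =
     (if even i then rev (a ((i + 6) mod 8)) @ rev (a ((i + 5) mod 8)) @ rev (a ((i + 4) mod 8))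
                       @ rev (a ((i + 3) mod 8)) @ rev (a ((i + 2) mod 8))
      else a ((i + 7) mod 8) @ a i @ a ((i + 1) mod 8))"

definition lift_paths ::
  "lift_type \<Rightarrow> leaper \<Rightarrow> (nat \<Rightarrow> square list) \<Rightarrow> nat \<Rightarrow> square list" where
  "lift_paths e L a i = map (\<lambda>z. z + lift_vector e L i) (lift_pieces e a i)"

text \<open>Successive lifts of types \<open>e\<^sub>j, \<dots>, e\<^sub>1\<close> for the string \<open>e\<^sub>1 \<dots> e\<^sub>j\<close>, starting from the frame of \<open>L\<close>.\<close>
fun lift_set_along :: "lift_type list \<Rightarrow> leaper \<Rightarrow> square set \<Rightarrow> square set" where
  "lift_set_along [] L S = S"
| "lift_set_along (e # es) L S = lift_set e (foldr lift_leaper es L) (lift_set_along es L S)"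

fun lift_paths_along ::
  "lift_type list \<Rightarrow> leaper \<Rightarrow> (nat \<Rightarrow> square list) \<Rightarrow> nat \<Rightarrow> square list" where
  "lift_paths_along [] L a = a"
| "lift_paths_along (e # es) L a = lift_paths e (foldr lift_leaper es L) (lift_paths_along es L a)"


section \<open>The canonical second leaper and its cycle\<close>

text \<open>\<open>canonical_second_basic L C M D\<close>: for the skew basic leaper \<open>L = (p, q)\<close>, \<open>p < q\<close>, and its
  cycle \<open>C\<close>, the canonical second leaper is \<open>M\<close> and the canonical second leaper cycle is \<open>D\<close>.
  Here \<open>ds = e\<^sub>1 \<dots> e\<^sub>j\<close> and \<open>es = e\<^sub>j\<^sub>+\<^sub>1 \<dots> e\<^sub>l\<close> make up the descent of \<open>L\<close>, and \<open>s i\<close> is the square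
  of the shell cycle \<open>C'\<close> in the section of direction \<open>i\<close>. The first
  character of \<open>es\<close> is never \<open>F\<close>, since \<open>lift_leaper F (m, n)\<close> violates the
  condition \<open>snd L \<le> 3 * fst L\<close> of \<open>shell_cycle\<close>.\<close>
definition canonical_second_basic ::
  "leaper \<Rightarrow> square list \<Rightarrow> leaper \<Rightarrow> square list \<Rightarrow> bool" where
  "canonical_second_basic L C M D \<longleftrightarrow>
     (\<exists>ds es C' s.
        L = leaper_of_descent (ds @ es) \<and>
        shell_cycle (leaper_of_descent es) C' \<and>
        set C = lift_set_along ds (leaper_of_descent es) (set C') \<and>
        M = (case es of [] \<Rightarrow> (0, 1) | e # es' \<Rightarrow> leaper_of_descent es') \<and>
        (\<forall>i<8. s i \<in> set C' \<inter> frame_section (leaper_of_descent es) i) \<and>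
        D = concat (map (lift_paths_along ds (leaper_of_descent es) (\<lambda>i. [s i])) [0..<8]))"

definition scaled_copy :: "nat \<Rightarrow> square \<Rightarrow> square \<Rightarrow> square" where
  "scaled_copy d t z = (int d * fst z, int d * snd z) + t"

text \<open>The general case: \<open>C\<close> is a copy, scaled by \<open>d = gcd p q\<close>, of a cycle \<open>C0\<close> of
  the basic leaper \<open>(p / d, q / d)\<close>, which is written with its smaller number first.\<close>
definition canonical_second ::
  "leaper \<Rightarrow> square list \<Rightarrow> leaper \<Rightarrow> square list \<Rightarrow> bool" where
  "canonical_second L C M D \<longleftrightarrow>
     (let d = gcd (fst L) (snd L);
          L0 = (min (fst L) (snd L) div d, max (fst L) (snd L) div d)
      in \<exists>t C0 M0 D0.
           leaper_cycle L0 (centered_board (fst L0 + snd L0)) C0 \<and>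
           C = map (scaled_copy d t) C0 \<and>
           canonical_second_basic L0 C0 M0 D0 \<and>
           M = (d * fst M0, d * snd M0) \<and>
           D = map (scaled_copy d t) D0)"

end

theory Submission
  imports Defs
begin

text \<open>The squares of the cycle \<open>C\<close> fall into the eight sections of the frame, and the second
  leaper cycle \<open>D\<close> traverses the sections one after the other. The theorem is proved by induction
  along the lifts in the following sharper form (locale \<open>split_cycle\<close>): within a section, the
  moves of \<open>M\<close> join exactly the consecutive squares of the piece of \<open>D\<close> there; between adjacent
  sections the only move is the one from the last square of a piece to the first square of the
  next; and there are no moves between other sections.

  Every piece of the lifted cycle is a translate of one, three or five consecutive pieces of the
  given one, possibly reversed, so moves inside a section are understood at once. Consider now a
  move between \<open>z + u\<close> and \<open>w + v\<close> in adjacent sections, where \<open>z\<close> and \<open>w\<close> belong to the given cycle and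
  \<open>u\<close>, \<open>v\<close> are the translation vectors of the sections. The vector \<open>u - v\<close> is always a move of the
  leaper \<open>(m, n)\<close> of the given frame, and \<open>C\<close> is closed under such moves inside the board. Hence
  \<open>z + (u - v)\<close> is another square of \<open>C\<close> (or the same argument applies to \<open>w\<close>), and the question is
  about a move of \<open>M\<close> between squares of \<open>C\<close>, where the induction hypothesis applies (\<open>lifted_link\<close>).
  That the ends of the pieces match is due to the relation \<open>diagonal\<close>: the end of each piece and
  the beginning of the third next piece differ by a move of the \<open>(m, n)\<close>-leaper. Both this
  relation and the closedness are preserved by lifting (\<open>lifted_diagonal\<close>, \<open>lifted_closed\<close>).

  For sections that are not adjacent there are two cases (\<open>lifted_apart\<close>). When the hole of the
  lifted frame is at least as wide as the longer proportion \<open>s\<close> of \<open>M\<close>, almost all of them are too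
  far apart; for sections like E and N under lifts of types \<open>F\<close> and \<open>H\<close>, the replacement argument,
  applied to both squares, leads back to sections that are not adjacent. This case covers every
  lift of type \<open>F\<close> or \<open>H\<close> and all that come later, since the width of the hole becomes \<open>m + n\<close> and
  never decreases. Otherwise only lifts of type \<open>G\<close> have been applied to a shell cycle. Then the
  position of the squares is known well enough (\<open>spots\<close>) to exclude moves by the parity of \<open>r + s\<close>.

  A shell cycle is a translate of a star with squares \<open>n - m\<close> away from the center along the axes
  and \<open>m\<close> away along the diagonals, for which everything can be checked directly
  (\<open>star_split_cycle\<close>). All the conditions are invariant under quarter turns, so only the
  directions E and NE need to be considered (\<open>split_cycle_turn_induct\<close>).\<close>

section \<open>Moves, quarter turns and sections\<close>

text \<open>The leaper move with integer proportions. In what follows, \<open>r < s\<close> are the proportions of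
  the second leaper \<open>M\<close>, while \<open>m < n\<close> are those of the leaper to which the frame belongs.\<close>

definition jump :: "int \<Rightarrow> int \<Rightarrow> square \<Rightarrow> square \<Rightarrow> bool" where
  "jump r s z w \<longleftrightarrow>
     \<bar>fst w - fst z\<bar> = r \<and> \<bar>snd w - snd z\<bar> = s \<or> \<bar>fst w - fst z\<bar> = s \<and> \<bar>snd w - snd z\<bar> = r"

lemma leaper_move_jump: "leaper_move (p, q) z w \<longleftrightarrow> jump (int p) (int q) z w"
  by (simp add: leaper_move_def jump_def)

lemma jump_sym: "jump r s z w \<longleftrightarrow> jump r s w z"
  by (simp add: jump_def abs_minus_commute)

lemma jump_diff: "w - z = w' - z' \<Longrightarrow> jump r s z w \<longleftrightarrow> jump r s z' w'"
  unfolding jump_def fst_diff [symmetric] snd_diff [symmetric] by simp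

lemma jump_translate [simp]: "jump r s (z + v) (w + v) \<longleftrightarrow> jump r s z w"
  by (rule jump_diff) simp

text \<open>The quarter turn clockwise, inverse to \<^const>\<open>quarter_turn\<close>.\<close>

definition turn_back :: "square \<Rightarrow> square" where
  "turn_back z = (snd z, - fst z)"

lemma turn_back_quarter_turn [simp]: "turn_back (quarter_turn z) = z" "quarter_turn (turn_back z) = z"
  by (simp_all add: turn_back_def quarter_turn_def)

lemma turn_back_add: "turn_back (z + w) = turn_back z + turn_back w"
  and turn_back_diff: "turn_back (z - w) = turn_back z - turn_back w"
  by (simp_all add: turn_back_def prod_eq_iff)

lemma inj_turn_back: "inj turn_back"
  by (metis injI turn_back_quarter_turn(2))

lemma turn_back_eq_iff [simp]: "turn_back z = turn_back w \<longleftrightarrow> z = w"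
  by (metis turn_back_quarter_turn(2))

lemma jump_turn_back [simp]: "jump r s (turn_back z) (turn_back w) \<longleftrightarrow> jump r s z w"
  by (auto simp: jump_def turn_back_def)

text \<open>A family of eight sets, one for each direction: \<open>A\<close> for E, \<open>B\<close> for NE, and their rotations
  for the other directions. The index is any natural number and counts modulo 8, so no reduction
  of indices is needed in what follows.\<close>

definition around :: "square set \<Rightarrow> square set \<Rightarrow> nat \<Rightarrow> square set" where
  "around A B i = (quarter_turn ^^ (i div 2)) ` (if even i then A else B)"

lemma mem_around_0: "z \<in> around A B 0 \<longleftrightarrow> z \<in> A"
  and mem_around_1: "z \<in> around A B (Suc 0) \<longleftrightarrow> z \<in> B"
  by (simp_all add: around_def)

lemma mem_around_step: "z \<in> around A B (Suc (Suc i)) \<longleftrightarrow> turn_back z \<in> around A B i"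
proof -
  have "around A B (Suc (Suc i)) = quarter_turn ` around A B i"
    by (simp add: around_def image_comp)
  also have "z \<in> \<dots> \<longleftrightarrow> turn_back z \<in> around A B i"
    by (metis image_iff turn_back_quarter_turn)
  finally show ?thesis .
qed

lemmas mem_around = mem_around_0 mem_around_1 mem_around_step

lemma mem_around_numeral:
  "z \<in> around A B 2 \<longleftrightarrow> turn_back z \<in> A"
  "z \<in> around A B 3 \<longleftrightarrow> turn_back z \<in> B"
  "z \<in> around A B 4 \<longleftrightarrow> - z \<in> A"
  "z \<in> around A B 5 \<longleftrightarrow> - z \<in> B"
  "z \<in> around A B 6 \<longleftrightarrow> quarter_turn z \<in> A"
  "z \<in> around A B 7 \<longleftrightarrow> quarter_turn z \<in> B"
  by (simp_all add: eval_nat_numeral mem_around, simp_all add: turn_back_def quarter_turn_def uminus_prod_def)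

text \<open>The section of direction \<open>i\<close> of the \<open>(m, n)\<close>-frame, in the parameters \<open>m\<close> and \<open>h\<close> with
  \<open>n = m + 2 h + 1\<close>. The hole consists of the squares with both coordinates at most \<open>h\<close> in absolute
  value and the frame reaches out to \<open>m + h\<close>; since \<open>m + n\<close> is odd, this removes all
  half-integers.\<close>

definition sector :: "int \<Rightarrow> int \<Rightarrow> nat \<Rightarrow> square set" where
  "sector m h = around {(x, y). h < x \<and> x \<le> m + h \<and> - h \<le> y \<and> y \<le> h}
                       {(x, y). h < x \<and> x \<le> m + h \<and> h < y \<and> y \<le> m + h}"

lemma mem_sector:
  "(x, y) \<in> sector m h 0 \<longleftrightarrow> h < x \<and> x \<le> m + h \<and> - h \<le> y \<and> y \<le> h"
  "(x, y) \<in> sector m h (Suc 0) \<longleftrightarrow> h < x \<and> x \<le> m + h \<and> h < y \<and> y \<le> m + h"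
  "(x, y) \<in> sector m h 2 \<longleftrightarrow> h < y \<and> y \<le> m + h \<and> - h \<le> x \<and> x \<le> h"
  "(x, y) \<in> sector m h 3 \<longleftrightarrow> h < y \<and> y \<le> m + h \<and> x < - h \<and> - (m + h) \<le> x"
  "(x, y) \<in> sector m h 4 \<longleftrightarrow> x < - h \<and> - (m + h) \<le> x \<and> - h \<le> y \<and> y \<le> h"
  "(x, y) \<in> sector m h 5 \<longleftrightarrow> x < - h \<and> - (m + h) \<le> x \<and> y < - h \<and> - (m + h) \<le> y"
  "(x, y) \<in> sector m h 6 \<longleftrightarrow> y < - h \<and> - (m + h) \<le> y \<and> - h \<le> x \<and> x \<le> h"
  "(x, y) \<in> sector m h 7 \<longleftrightarrow> h < x \<and> x \<le> m + h \<and> y < - h \<and> - (m + h) \<le> y"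
  by (simp_all add: sector_def mem_around_numeral mem_around turn_back_def quarter_turn_def, safe, linarith+)

lemma mem_sector_step: "z \<in> sector m h (Suc (Suc i)) \<longleftrightarrow> turn_back z \<in> sector m h i"
  by (simp add: sector_def mem_around)


section \<open>Induced paths\<close>

text \<open>The ordered pairs of consecutive elements of a list.\<close>

definition consecutive :: "'a list \<Rightarrow> ('a \<times> 'a) set" where
  "consecutive xs = set (zip xs (tl xs))"

lemma consecutive_simps [simp]:
  "consecutive [] = {}" "consecutive [x] = {}"
  "consecutive (x # y # xs) = insert (x, y) (consecutive (y # xs))"
  by (simp_all add: consecutive_def)

lemma consecutive_append:
  "xs \<noteq> [] \<Longrightarrow> ys \<noteq> [] \<Longrightarrow>
     consecutive (xs @ ys) = consecutive xs \<union> consecutive ys \<union> {(last xs, hd ys)}"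
proof (induction xs rule: induct_list012)
  case (2 x)
  then show ?case by (cases ys) auto
qed auto

lemma consecutive_rev: "consecutive (rev xs) = (consecutive xs)\<inverse>"
proof (induction xs rule: induct_list012)
  case (3 x y zs)
  have "consecutive (rev (x # y # zs)) = consecutive (rev (y # zs) @ [x])" by simp
  also have "\<dots> = consecutive (rev (y # zs)) \<union> {(y, x)}"
    by (subst consecutive_append) auto
  finally show ?case using 3 by auto
qed auto

lemma consecutive_map: "consecutive (map f xs) = map_prod f f ` consecutive xs"
  by (induction xs rule: induct_list012) auto

lemma consecutive_subset: "consecutive xs \<subseteq> set xs \<times> set xs"
  by (induction xs rule: induct_list012) auto

lemma consecutive_nth: "consecutive xs = {(xs ! i, xs ! Suc i) | i. Suc i < length xs}"
  by (auto simp: consecutive_def set_zip nth_tl)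

text \<open>Adjacency in the path given by a list.\<close>

definition joined :: "'a list \<Rightarrow> 'a \<Rightarrow> 'a \<Rightarrow> bool" where
  "joined xs z w \<longleftrightarrow> (z, w) \<in> consecutive xs \<or> (w, z) \<in> consecutive xs"

text \<open>The moves between squares of the list are exactly the edges of the path.\<close>

definition induced_path :: "int \<Rightarrow> int \<Rightarrow> square list \<Rightarrow> bool" where
  "induced_path r s xs \<longleftrightarrow> xs \<noteq> [] \<and> (\<forall>z\<in>set xs. \<forall>w\<in>set xs. jump r s z w \<longleftrightarrow> joined xs z w)"

text \<open>The only move between the two lists leads from the end of the first to the beginning of
  the second.\<close>

definition linked :: "int \<Rightarrow> int \<Rightarrow> square list \<Rightarrow> square list \<Rightarrow> bool" where
  "linked r s xs ys \<longleftrightarrow> (\<forall>z\<in>set xs. \<forall>w\<in>set ys. jump r s z w \<longleftrightarrow> z = last xs \<and> w = hd ys)"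

text \<open>There is no move between the two lists.\<close>

definition apart :: "int \<Rightarrow> int \<Rightarrow> square list \<Rightarrow> square list \<Rightarrow> bool" where
  "apart r s xs ys \<longleftrightarrow> (\<forall>z\<in>set xs. \<forall>w\<in>set ys. \<not> jump r s z w)"

lemma apart_sym: "apart r s xs ys \<Longrightarrow> apart r s ys xs"
  by (auto simp: apart_def jump_sym)

lemma apart_append [simp]:
  "apart r s (xs @ ys) zs \<longleftrightarrow> apart r s xs zs \<and> apart r s ys zs"
  "apart r s zs (xs @ ys) \<longleftrightarrow> apart r s zs xs \<and> apart r s zs ys"
  by (auto simp: apart_def)

lemma linked_append1:
  "linked r s ys zs \<Longrightarrow> apart r s xs zs \<Longrightarrow> ys \<noteq> [] \<Longrightarrow> zs \<noteq> [] \<Longrightarrow> linked r s (xs @ ys) zs"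
  by (auto simp: linked_def apart_def)

lemma linked_append2:
  "linked r s xs ys \<Longrightarrow> apart r s xs zs \<Longrightarrow> ys \<noteq> [] \<Longrightarrow> xs \<noteq> [] \<Longrightarrow> linked r s xs (ys @ zs)"
  by (auto simp: linked_def apart_def)

lemma induced_path_append:
  assumes "induced_path r s xs" "induced_path r s ys" "linked r s xs ys"
  shows "induced_path r s (xs @ ys)"
proof -
  have ne: "xs \<noteq> []" "ys \<noteq> []" using assms by (auto simp: induced_path_def)
  have j: "joined (xs @ ys) z w \<longleftrightarrow> joined xs z w \<or> joined ys z w \<or> (z = last xs \<and> w = hd ys)
      \<or> (w = last xs \<and> z = hd ys)" for z w
    using ne by (auto simp: joined_def consecutive_append)
  have sub: "joined zs z w \<Longrightarrow> z \<in> set zs \<and> w \<in> set zs" for zs :: "square list" and z w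
    using consecutive_subset by (fastforce simp: joined_def)
  have last: "jump r s (last xs) (hd ys)" "jump r s (hd ys) (last xs)"
    using assms(3) ne jump_sym by (auto simp: linked_def)
  have x: "jump r s z w \<longleftrightarrow> joined xs z w" if "z \<in> set xs" "w \<in> set xs" for z w
    using assms(1) that by (auto simp: induced_path_def)
  have y: "jump r s z w \<longleftrightarrow> joined ys z w" if "z \<in> set ys" "w \<in> set ys" for z w
    using assms(2) that by (auto simp: induced_path_def)
  have l: "jump r s z w \<longleftrightarrow> z = last xs \<and> w = hd ys" if "z \<in> set xs" "w \<in> set ys" for z w
    using assms(3) that by (auto simp: linked_def)
  have "jump r s z w" if "joined (xs @ ys) z w" for z w
    using that unfolding j using x[of z w] y[of z w] sub[of xs z w] sub[of ys z w] last by blast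
  moreover have "joined (xs @ ys) z w"
    if zw: "z \<in> set xs \<union> set ys" "w \<in> set xs \<union> set ys" and jmp: "jump r s z w" for z w
    using zw jmp jump_sym[of r s z w] x[of z w] y[of z w] l[of z w] l[of w z] unfolding j by blast
  ultimately have "jump r s z w \<longleftrightarrow> joined (xs @ ys) z w"
    if "z \<in> set xs \<union> set ys" "w \<in> set xs \<union> set ys" for z w
    using that by blast
  with ne show ?thesis
    unfolding induced_path_def set_append append_is_Nil_conv by blast
qed

lemma induced_path_rev: "induced_path r s xs \<Longrightarrow> induced_path r s (rev xs)"
  by (auto simp: induced_path_def joined_def consecutive_rev)

lemma joined_map: "inj f \<Longrightarrow> joined (map f xs) (f z) (f w) \<longleftrightarrow> joined xs z w"
  by (auto simp: joined_def consecutive_map inj_def)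

lemma path_properties_map:
  assumes "inj f" and "\<And>z w. jump r s (f z) (f w) \<longleftrightarrow> jump r s z w"
  shows "induced_path r s (map f xs) \<longleftrightarrow> induced_path r s xs"
    and "xs \<noteq> [] \<Longrightarrow> ys \<noteq> [] \<Longrightarrow> linked r s (map f xs) (map f ys) \<longleftrightarrow> linked r s xs ys"
    and "apart r s (map f xs) (map f ys) \<longleftrightarrow> apart r s xs ys"
  using assms
  by (auto simp: induced_path_def joined_map linked_def apart_def last_map hd_map inj_eq)


section \<open>Split cycles and their lifts\<close>

text \<open>The parameters \<open>m\<close> and \<open>h\<close> of the lifted frame.\<close>

definition lift_m :: "lift_type \<Rightarrow> int \<Rightarrow> int \<Rightarrow> int" where
  "lift_m e m h = (case e of F \<Rightarrow> m | G \<Rightarrow> m + 2 * h + 1 | H \<Rightarrow> m + 2 * h + 1)"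

definition lift_h :: "lift_type \<Rightarrow> int \<Rightarrow> int \<Rightarrow> int" where
  "lift_h e m h = (case e of F \<Rightarrow> m + h | G \<Rightarrow> h | H \<Rightarrow> m + h)"

text \<open>The translation vector of \<^const>\<open>lift_vector\<close> in terms of \<open>m\<close> and \<open>h\<close>.\<close>

definition shift :: "lift_type \<Rightarrow> int \<Rightarrow> int \<Rightarrow> nat \<Rightarrow> square" where
  "shift e m h i =
     (let k = (case e of
                 F \<Rightarrow> if even i then 2 * m + 2 * h + 1 else m
               | G \<Rightarrow> if even i then 2 * h + 1 else m + 2 * h + 1
               | H \<Rightarrow> if even i then 2 * m + 2 * h + 1 else m + 2 * h + 1)
      in (k * fst (direction i), k * snd (direction i)))"

lemma direction_step: "direction (Suc (Suc i)) = quarter_turn (direction i)"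
  by (simp add: direction_def)

lemma direction_simps [simp]:
  "direction 0 = (1, 0)" "direction (Suc 0) = (1, 1)" "direction 2 = (0, 1)" "direction 3 = (-1, 1)"
  "direction 4 = (-1, 0)" "direction 5 = (-1, -1)" "direction 6 = (0, -1)" "direction 7 = (1, -1)"
proof -
  show 0: "direction 0 = (1, 0)" and 1: "direction (Suc 0) = (1, 1)"
    by (simp_all add: direction_def)
  show "direction 2 = (0, 1)" "direction 3 = (-1, 1)" "direction 4 = (-1, 0)"
    "direction 5 = (-1, -1)" "direction 6 = (0, -1)" "direction 7 = (1, -1)"
    by (simp_all add: eval_nat_numeral direction_step 0 1, simp_all add: quarter_turn_def)
qed

lemma direction_8: "direction (i + 8) = direction i"
  by (simp add: eval_nat_numeral direction_step quarter_turn_def)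

lemma shift_step: "turn_back (shift e m h (Suc (Suc i))) = shift e m h i"
  by (cases e) (simp_all add: shift_def Let_def direction_step turn_back_def quarter_turn_def)

lemma shift_8: "shift e m h (i + 8) = shift e m h i"
  by (simp add: shift_def direction_8)

text \<open>The pieces of a split cycle after a clockwise quarter turn of the whole board, which
  sends the piece of direction \<open>i + 2\<close> to direction \<open>i\<close>.\<close>

definition turned :: "(nat \<Rightarrow> square list) \<Rightarrow> nat \<Rightarrow> square list" where
  "turned a i = map turn_back (a (Suc (Suc i)))"

text \<open>All squares of a split cycle.\<close>

definition squares :: "(nat \<Rightarrow> square list) \<Rightarrow> square set" where
  "squares a = (\<Union>i. set (a i))"

lemma squares_turned:
  assumes "\<And>i. a (i + 8) = a i"
  shows "squares (turned a) = turn_back ` squares a"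
proof -
  have "set (a i) \<subseteq> (\<Union>i. set (a (Suc (Suc i))))" for i
    using assms [of i] UN_upper[of "i + 6" UNIV "\<lambda>i. set (a (Suc (Suc i)))"] by (simp add: eval_nat_numeral)
  then have "squares a = (\<Union>i. set (a (Suc (Suc i))))"
    by (auto simp: squares_def)
  then show ?thesis by (auto simp: turned_def squares_def)
qed

text \<open>The lift of a split cycle whose pieces are indexed by all natural numbers, with period
  8.\<close>

definition lifted :: "lift_type \<Rightarrow> int \<Rightarrow> int \<Rightarrow> (nat \<Rightarrow> square list) \<Rightarrow> nat \<Rightarrow> square list" where
  "lifted e m h a i = map (\<lambda>z. z + shift e m h i) (lift_pieces e a i)"

text \<open>A region that contains the squares of a cycle, relative to the center of the shell cycle
  from which it arose, as long as only lifts of type \<open>G\<close> have been applied. In the directions E,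
  N, W, S it is a single point at distance \<open>k\<close>. In the others, a square \<open>(x, y)\<close> is of the first
  kind, with \<open>\<bar>x\<bar> + \<bar>y\<bar> = k\<close>, or of the second kind, with both coordinates at least \<open>s\<close> in absolute
  value and \<open>\<bar>x\<bar> + \<bar>y\<bar> = m + s\<close>.\<close>

definition spots :: "int \<Rightarrow> int \<Rightarrow> int \<Rightarrow> nat \<Rightarrow> square set" where
  "spots m h s = (let k = m + 2 * h + 1 - s in
     around {(k, 0)}
            {(x, y). 0 < x \<and> 0 < y \<and> (x + y = k \<or> s \<le> x \<and> s \<le> y \<and> x + y = m + s)})"

text \<open>The statement carried along the lifts: the pieces \<open>a 0, \<dots>, a 7\<close>, repeated with period 8,
  form a cycle of the \<open>(r, s)\<close>-leaper in the \<open>(m, n)\<close>-frame, \<open>n = m + 2 h + 1\<close>, whose edges are all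
  moves of this leaper between its squares. Directions at distance 5 and 6 are covered by those
  at distance 3 and 2. The assumption \<open>diagonal\<close> says that the end of a piece and the beginning of
  the third next one differ by a certain move of the \<open>(m, n)\<close>-leaper, and \<open>closed\<close> that the set of
  squares contains, with every square, its neighbours in the graph of the \<open>(m, n)\<close>-leaper over the
  board. Finally, \<open>spread\<close> says that the hole is too wide to be crossed by a move, or else that
  the positions of the squares are known.\<close>

locale split_cycle =
  fixes m h r s :: int and a :: "nat \<Rightarrow> square list"
  assumes params: "0 \<le> h" "0 \<le> r" "r < s" "s \<le> m" "odd (r + s)"
    and periodic: "a (i + 8) = a i"
    and in_sector: "set (a i) \<subseteq> sector m h i"
    and path: "induced_path r s (a i)"
    and link: "linked r s (a i) (a (Suc i))"
    and nonadjacent: "k \<in> {2, 3, 4} \<Longrightarrow> apart r s (a i) (a (i + k))"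
    and diagonal: "hd (a (i + 3)) - last (a i) \<in>
                     around {(- (m + 2 * h + 1), m)} {(- (m + 2 * h + 1), - m)} i"
    and closed: "z \<in> squares a \<Longrightarrow> jump m (m + 2 * h + 1) z w \<Longrightarrow>
                   \<bar>fst w\<bar> \<le> m + h \<Longrightarrow> \<bar>snd w\<bar> \<le> m + h \<Longrightarrow> w \<in> squares a"
    and spread: "s \<le> 2 * h + 1 \<or> (\<exists>t. \<forall>i. \<forall>z\<in>set (a i). z - t \<in> spots m h s i)"
begin

lemma nonempty [simp]: "a i \<noteq> []"
  using path [of i] by (simp add: induced_path_def)

lemma turned_split_cycle: "split_cycle m h r s (turned a)"
proof
  fix i k :: nat and z w :: square
  note map_rules = path_properties_map [of turn_back, OF inj_turn_back jump_turn_back]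
  show "turned a (i + 8) = turned a i"
    using periodic [of "Suc (Suc i)"] by (simp add: turned_def)
  show "set (turned a i) \<subseteq> sector m h i"
    using in_sector [of "Suc (Suc i)"] by (auto simp: turned_def mem_sector_step)
  show "induced_path r s (turned a i)"
    using path by (simp add: turned_def map_rules)
  show "linked r s (turned a i) (turned a (Suc i))"
    using link by (simp add: turned_def map_rules)
  show "apart r s (turned a i) (turned a (i + k))" if "k \<in> {2, 3, 4}"
    using nonadjacent [OF that, of "Suc (Suc i)"] by (simp add: turned_def map_rules)
  show "hd (turned a (i + 3)) - last (turned a i) \<in>
          around {(- (m + 2 * h + 1), m)} {(- (m + 2 * h + 1), - m)} i"
    using diagonal [of "Suc (Suc i)"]
    by (simp add: turned_def hd_map last_map mem_around turn_back_diff)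
  show "w \<in> squares (turned a)"
    if z: "z \<in> squares (turned a)" and "jump m (m + 2 * h + 1) z w"
      "\<bar>fst w\<bar> \<le> m + h" "\<bar>snd w\<bar> \<le> m + h"
  proof -
    obtain z' where z': "z = turn_back z'" "z' \<in> squares a"
      using z unfolding squares_turned [of a, OF periodic] by blast
    have "quarter_turn w \<in> squares a"
      by (rule closed [OF z'(2)], metis that(2) z'(1) jump_turn_back turn_back_quarter_turn(1))
         (use that in \<open>simp_all add: quarter_turn_def\<close>)
    then show ?thesis by (metis squares_turned [of a, OF periodic] image_eqI turn_back_quarter_turn(1))
  qed
  show "s \<le> 2 * h + 1 \<or> (\<exists>t. \<forall>i. \<forall>z\<in>set (turned a i). z - t \<in> spots m h s i)"
  proof -
    have "\<forall>z\<in>set (turned a i). z - turn_back t \<in> spots m h s i"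
      if "\<forall>i. \<forall>z\<in>set (a i). z - t \<in> spots m h s i" for t i
      using that [rule_format, of _ "Suc (Suc i)"]
      by (auto simp: turned_def spots_def Let_def mem_around turn_back_diff)
    then show ?thesis using spread by blast
  qed
qed (use params in auto)

lemma a_mod_8: "a (j mod 8) = a j"
proof (induction j rule: less_induct)
  case (less j)
  then show ?case
    using periodic [of "j - 8"] le_mod_geq [of 8 j] by (cases "j < 8") auto
qed

lemma lift_pieces_simps:
  "lift_pieces F a i =
     (if even i then rev (a (i + 5)) @ rev (a (i + 4)) @ rev (a (i + 3)) else a i)"
  "lift_pieces G a i =
     (if even i then a i else rev (a (i + 5)) @ rev (a (i + 4)) @ rev (a (i + 3)))"
  "lift_pieces H a i =
     (if even i
      then rev (a (i + 6)) @ rev (a (i + 5)) @ rev (a (i + 4)) @ rev (a (i + 3)) @ rev (a (i + 2))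
      else a (i + 7) @ a i @ a (i + 1))"
  by (simp_all add: a_mod_8)

lemma lift_pieces_nonempty [simp]: "lift_pieces e a i \<noteq> []"
  and lifted_nonempty [simp]: "lifted e m h a i \<noteq> []"
  by (cases e; simp add: lift_pieces_simps lifted_def)+

lemma lifted_turned: "lifted e m h (turned a) = turned (lifted e m h a)"
proof
  fix i
  interpret T: split_cycle m h r s "turned a" by (rule turned_split_cycle)
  have "lift_pieces e (turned a) i = map turn_back (lift_pieces e a (Suc (Suc i)))"
    by (cases e) (simp_all add: T.lift_pieces_simps lift_pieces_simps turned_def rev_map
        del: lift_pieces.simps)
  then show "lifted e m h (turned a) i = turned (lifted e m h a) i"
    by (simp add: lifted_def turned_def turn_back_add shift_step)
qed

lemma lifted_8: "lifted e m h a (i + 8) = lifted e m h a i"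
proof -
  have "a (i + 8 + j) = a (i + j)" for j using periodic [of "i + j"] by (simp add: ac_simps)
  from this [of 0] this [of 1] this [of 2] this [of 3] this [of 4] this [of 5] this [of 6] this [of 7]
  show ?thesis
    by (cases e) (simp_all add: lifted_def lift_pieces_simps shift_8 ac_simps
        del: lift_pieces.simps)
qed

end

text \<open>By rotational symmetry, a property of all split cycles need only be checked for the
  directions E and NE.\<close>

lemma split_cycle_turn_induct [consumes 1, case_names E NE turn]:
  assumes "split_cycle m h r s a"
    and E: "\<And>b. split_cycle m h r s b \<Longrightarrow> P b 0"
    and NE: "\<And>b. split_cycle m h r s b \<Longrightarrow> P b (Suc 0)"
    and turn: "\<And>b i. split_cycle m h r s b \<Longrightarrow> P (turned b) i \<Longrightarrow> P b (Suc (Suc i))"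
  shows "P a i"
  using assms(1)
proof (induction i arbitrary: a rule: induct_nat_012)
  case (ge2 n)
  then show ?case using turn split_cycle.turned_split_cycle by blast
qed (use E NE in auto)


section \<open>Squares of the lift\<close>

lemma linked_translate:
  assumes "\<And>z w. z \<in> set xs \<Longrightarrow> w \<in> set ys \<Longrightarrow> jump r s (z + u) (w + v) \<longleftrightarrow> z = last xs \<and> w = hd ys"
  shows "xs \<noteq> [] \<Longrightarrow> ys \<noteq> [] \<Longrightarrow> linked r s (map (\<lambda>z. z + u) xs) (map (\<lambda>w. w + v) ys)"
  using assms by (auto simp: linked_def last_map hd_map)

lemma lift_pieces_E_NE_N:
  "lift_pieces F a 0 = rev (a 5) @ rev (a 4) @ rev (a 3)"
  "lift_pieces F a (Suc 0) = a (Suc 0)"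
  "lift_pieces F a 2 = rev (a 7) @ rev (a 6) @ rev (a 5)"
  "lift_pieces G a 0 = a 0"
  "lift_pieces G a (Suc 0) = rev (a 6) @ rev (a 5) @ rev (a 4)"
  "lift_pieces G a 2 = a 2"
  "lift_pieces H a 0 = rev (a 6) @ rev (a 5) @ rev (a 4) @ rev (a 3) @ rev (a 2)"
  "lift_pieces H a (Suc 0) = a 0 @ a (Suc 0) @ a 2"
  "lift_pieces H a 2 = rev (a 0) @ rev (a 7) @ rev (a 6) @ rev (a 5) @ rev (a 4)"
  by (simp_all, simp_all add: numeral_2_eq_2)

lemma less_8_cases:
  fixes i :: nat
  shows "i < 8 \<Longrightarrow> i = 0 \<or> i = Suc 0 \<or> i = 2 \<or> i = 3 \<or> i = 4 \<or> i = 5 \<or> i = 6 \<or> i = 7"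
  by auto

context split_cycle
begin

lemma squares_sector:
  assumes "z \<in> squares a"
  obtains i where "i < 8" "z \<in> set (a i)" "z \<in> sector m h i"
proof -
  obtain i where i: "z \<in> set (a i)" using assms by (auto simp: squares_def)
  have "z \<in> set (a (i mod 8))" using i a_mod_8 [of i] by simp
  then show thesis using that [of "i mod 8"] in_sector by force
qed

lemma squares_cases:
  assumes "(x, y) \<in> squares a"
  obtains (E) "(x, y) \<in> set (a 0)" "h < x" "x \<le> m + h" "- h \<le> y" "y \<le> h"
    | (NE) "(x, y) \<in> set (a (Suc 0))" "h < x" "x \<le> m + h" "h < y" "y \<le> m + h"
    | (N) "(x, y) \<in> set (a 2)" "h < y" "y \<le> m + h" "- h \<le> x" "x \<le> h"
    | (NW) "(x, y) \<in> set (a 3)" "h < y" "y \<le> m + h" "x < - h" "- (m + h) \<le> x"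
    | (W) "(x, y) \<in> set (a 4)" "x < - h" "- (m + h) \<le> x" "- h \<le> y" "y \<le> h"
    | (SW) "(x, y) \<in> set (a 5)" "x < - h" "- (m + h) \<le> x" "y < - h" "- (m + h) \<le> y"
    | (S) "(x, y) \<in> set (a 6)" "y < - h" "- (m + h) \<le> y" "- h \<le> x" "x \<le> h"
    | (SE) "(x, y) \<in> set (a 7)" "h < x" "x \<le> m + h" "y < - h" "- (m + h) \<le> y"
proof -
  obtain i where i: "i < 8" "(x, y) \<in> set (a i)" "(x, y) \<in> sector m h i"
    by (rule squares_sector [OF assms])
  from less_8_cases [OF i(1)] show thesis
  proof (elim disjE)
    assume "i = 0" with i(2,3) show thesis by (intro E) (simp_all add: mem_sector)
  next
    assume "i = Suc 0" with i(2,3) show thesis by (intro NE) (simp_all add: mem_sector)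
  next
    assume "i = 2" with i(2,3) show thesis by (intro N) (simp_all add: mem_sector)
  next
    assume "i = 3" with i(2,3) show thesis by (intro NW) (simp_all add: mem_sector)
  next
    assume "i = 4" with i(2,3) show thesis by (intro W) (simp_all add: mem_sector)
  next
    assume "i = 5" with i(2,3) show thesis by (intro SW) (simp_all add: mem_sector)
  next
    assume "i = 6" with i(2,3) show thesis by (intro S) (simp_all add: mem_sector)
  next
    assume "i = 7" with i(2,3) show thesis by (intro SE) (simp_all add: mem_sector)
  qed
qed

lemma set_a_squares: "z \<in> set (a i) \<Longrightarrow> z \<in> squares a"
  by (auto simp: squares_def)

lemma mem_lifted_E:
  "(x, y) \<in> set (lifted e m h a 0) \<longleftrightarrow>
     (x, y) \<in> sector (lift_m e m h) (lift_h e m h) 0 \<and> (x, y) - shift e m h 0 \<in> squares a"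
proof -
  define k where "k = (case e of G \<Rightarrow> 2 * h + 1 | _ \<Rightarrow> 2 * m + 2 * h + 1)"
  have k: "(x, y) - shift e m h 0 = (x - k, y)"
    by (cases e) (simp_all add: shift_def Let_def k_def)
  have l: "(x, y) \<in> set (lifted e m h a 0) \<longleftrightarrow> (x - k, y) \<in> set (lift_pieces e a 0)"
    by (cases e) (force simp: lifted_def shift_def Let_def image_iff k_def)+
  have mem: "\<And>x y i. (x, y) \<in> set (a i) \<Longrightarrow> (x, y) \<in> sector m h i \<and> (x, y) \<in> squares a"
    using in_sector set_a_squares by blast
  have down: "(x, y) \<in> sector (lift_m e m h) (lift_h e m h) 0 \<and> (x - k, y) \<in> squares a"
    if "(x - k, y) \<in> set (lift_pieces e a 0)"
    using that params(1-4)
    by (cases e) (auto simp: lift_pieces_E_NE_N k_def lift_m_def lift_h_def mem_sector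
        simp del: lift_pieces.simps dest!: mem)
  have up: "(x - k, y) \<in> set (lift_pieces e a 0)"
    if "(x, y) \<in> sector (lift_m e m h) (lift_h e m h) 0" "(x - k, y) \<in> squares a"
    using that(1) params(1-4)
    by (cases rule: squares_cases [OF that(2)]; cases e)
       (simp_all add: lift_pieces_E_NE_N k_def lift_m_def lift_h_def mem_sector del: lift_pieces.simps)
  show ?thesis unfolding l k using down up by blast
qed

lemma mem_lifted_NE:
  "(x, y) \<in> set (lifted e m h a (Suc 0)) \<longleftrightarrow>
     (x, y) \<in> sector (lift_m e m h) (lift_h e m h) (Suc 0) \<and> (x, y) - shift e m h (Suc 0) \<in> squares a"
proof -
  define k where "k = (case e of F \<Rightarrow> m | _ \<Rightarrow> m + 2 * h + 1)"
  have k: "(x, y) - shift e m h (Suc 0) = (x - k, y - k)"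
    by (cases e) (simp_all add: shift_def Let_def k_def)
  have l: "(x, y) \<in> set (lifted e m h a (Suc 0)) \<longleftrightarrow> (x - k, y - k) \<in> set (lift_pieces e a (Suc 0))"
    by (cases e) (force simp: lifted_def shift_def Let_def image_iff k_def)+
  have mem: "\<And>x y i. (x, y) \<in> set (a i) \<Longrightarrow> (x, y) \<in> sector m h i \<and> (x, y) \<in> squares a"
    using in_sector set_a_squares by blast
  have down: "(x, y) \<in> sector (lift_m e m h) (lift_h e m h) (Suc 0) \<and> (x - k, y - k) \<in> squares a"
    if "(x - k, y - k) \<in> set (lift_pieces e a (Suc 0))"
    using that params(1-4)
    by (cases e) (auto simp: lift_pieces_E_NE_N k_def lift_m_def lift_h_def mem_sector
        simp del: lift_pieces.simps dest!: mem)
  have up: "(x - k, y - k) \<in> set (lift_pieces e a (Suc 0))"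
    if "(x, y) \<in> sector (lift_m e m h) (lift_h e m h) (Suc 0)" "(x - k, y - k) \<in> squares a"
    using that(1) params(1-4)
    by (cases rule: squares_cases [OF that(2)]; cases e)
       (simp_all add: lift_pieces_E_NE_N k_def lift_m_def lift_h_def mem_sector del: lift_pieces.simps)
  show ?thesis unfolding l k using down up by blast
qed

text \<open>A piece of the lift consists of those translates of squares of the cycle that fall into
  the section; this compares \<^const>\<open>lift_pieces\<close> with \<^const>\<open>lift_set\<close>.\<close>

lemma mem_set_lifted:
  "z \<in> set (lifted e m h a i) \<longleftrightarrow>
     z \<in> sector (lift_m e m h) (lift_h e m h) i \<and> z - shift e m h i \<in> squares a"
  using split_cycle_axioms
proof (induction a i arbitrary: z rule: split_cycle_turn_induct)
  case (E b)
  then show ?case using split_cycle.mem_lifted_E [of m h r s b] by (cases z) blast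
next
  case (NE b)
  then show ?case using split_cycle.mem_lifted_NE [of m h r s b] by (cases z) blast
next
  case (turn b i)
  then interpret B: split_cycle m h r s b by simp
  have "z \<in> set (lifted e m h b (Suc (Suc i))) \<longleftrightarrow> turn_back z \<in> set (lifted e m h (turned b) i)"
    unfolding B.lifted_turned by (simp add: turned_def image_iff)
  also have "\<dots> \<longleftrightarrow> turn_back z \<in> sector (lift_m e m h) (lift_h e m h) i \<and>
      turn_back (z - shift e m h (Suc (Suc i))) \<in> turn_back ` squares b"
    unfolding turn(2) turn_back_diff shift_step squares_turned [of b, OF B.periodic] ..
  finally show ?case by (simp add: mem_sector_step inj_image_mem_iff [OF inj_turn_back])
qed

end


section \<open>Separation by parity\<close>

lemma jump_bound:
  assumes "jump r s z w" "r < s"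
  shows "\<bar>fst w - fst z\<bar> \<le> s" "\<bar>snd w - snd z\<bar> \<le> s"
  using assms by (auto simp: jump_def)

lemma spots_step: "z \<in> spots m h s (Suc (Suc i)) \<longleftrightarrow> turn_back z \<in> spots m h s i"
  by (simp add: spots_def Let_def mem_around)

lemma mem_spots:
  fixes m h s :: int
  defines "k \<equiv> m + 2 * h + 1 - s"
  shows "(x, y) \<in> spots m h s 0 \<longleftrightarrow> x = k \<and> y = 0"
  "(x, y) \<in> spots m h s (Suc 0) \<longleftrightarrow> 0 < x \<and> 0 < y \<and> (x + y = k \<or> s \<le> x \<and> s \<le> y \<and> x + y = m + s)"
  "(x, y) \<in> spots m h s 2 \<longleftrightarrow> x = 0 \<and> y = k"
  "(x, y) \<in> spots m h s 3 \<longleftrightarrow> x < 0 \<and> 0 < y \<and> (y - x = k \<or> x \<le> - s \<and> s \<le> y \<and> y - x = m + s)"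
  "(x, y) \<in> spots m h s 4 \<longleftrightarrow> x = - k \<and> y = 0"
  "(x, y) \<in> spots m h s 5 \<longleftrightarrow> x < 0 \<and> y < 0 \<and> (x + y = - k \<or> x \<le> - s \<and> y \<le> - s \<and> x + y = - (m + s))"
  "(x, y) \<in> spots m h s 6 \<longleftrightarrow> x = 0 \<and> y = - k"
  by (auto simp: spots_def Let_def mem_around mem_around_numeral turn_back_def quarter_turn_def k_def)

text \<open>A move changes the sum of the coordinates by an odd number. This rules out moves between
  two squares with \<open>\<bar>x\<bar> + \<bar>y\<bar> = k\<close>; a move from a square of the second kind into a section that is
  not adjacent would be longer than \<open>s\<close> in some coordinate.\<close>

lemma spots_no_jump:
  assumes "odd (r + s)" "0 \<le> r" "r < s" "s \<le> m" "0 \<le> h" "k \<in> {2, 3, 4}"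
    and "z \<in> spots m h s i" "w \<in> spots m h s (i + k)"
  shows "\<not> jump r s z w"
proof -
  define c where "c = m + 2 * h + 1 - s"
  have pos: "0 < m + 2 * h + 1 - s" "0 < s" using assms by linarith+
  show ?thesis
    using assms(7,8)
  proof (induction i arbitrary: z w rule: induct_nat_012)
    case 0
    obtain x y x' y' where z: "z = (x, y)" and w: "w = (x', y')" by (metis surj_pair)
    show ?case
    proof
      assume "jump r s z w"
      then have sum: "r + s = \<bar>x' - x\<bar> + \<bar>y' - y\<bar>" and le: "\<bar>x' - x\<bar> \<le> s" "\<bar>y' - y\<bar> \<le> s"
        using assms(3) by (auto simp: jump_def z w)
      have k: "k = 2 \<or> k = 3 \<or> k = 4" using assms(6) by simp
      have spots: "(x, y) \<in> spots m h s 0" "(x', y') \<in> spots m h s k"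
        using 0 by (simp_all add: z w)
      have "r + s = 2 * c \<or> r + s = 2 * (c - y) \<or> r + s = 2 * (c - y')"
        using k
      proof (elim disjE)
        assume "k = 2"
        with spots have "(x, y) \<in> spots m h s 0" "(x', y') \<in> spots m h s 2" by simp_all
        then show ?thesis unfolding mem_spots c_def using sum le pos by (smt (verit))
      next
        assume "k = 3"
        with spots have "(x, y) \<in> spots m h s 0" "(x', y') \<in> spots m h s 3" by simp_all
        then show ?thesis unfolding mem_spots c_def using sum le pos by (smt (verit))
      next
        assume "k = 4"
        with spots have "(x, y) \<in> spots m h s 0" "(x', y') \<in> spots m h s 4" by simp_all
        then show ?thesis unfolding mem_spots c_def using sum le pos by (smt (verit))
      qed
      then show False using assms(1) by presburger
    qed
  next
    case 1
    obtain x y x' y' where z: "z = (x, y)" and w: "w = (x', y')" by (metis surj_pair)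
    show ?case
    proof
      assume "jump r s z w"
      then have sum: "r + s = \<bar>x' - x\<bar> + \<bar>y' - y\<bar>" and le: "\<bar>x' - x\<bar> \<le> s" "\<bar>y' - y\<bar> \<le> s"
        using assms(3) by (auto simp: jump_def z w)
      have k: "k = 2 \<or> k = 3 \<or> k = 4" using assms(6) by simp
      have spots: "(x, y) \<in> spots m h s (Suc 0)" "(x', y') \<in> spots m h s (Suc k)"
        using 1 by (simp_all add: z w)
      have "r + s = 2 * c \<or> r + s = 2 * (c - y) \<or> r + s = 2 * (c - y')"
        using k
      proof (elim disjE)
        assume "k = 2"
        with spots have "(x, y) \<in> spots m h s (Suc 0)" "(x', y') \<in> spots m h s 3" by simp_all
        then show ?thesis unfolding mem_spots c_def using sum le pos by (smt (verit))
      next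
        assume "k = 3"
        with spots have "(x, y) \<in> spots m h s (Suc 0)" "(x', y') \<in> spots m h s 4" by simp_all
        then show ?thesis unfolding mem_spots c_def using sum le pos by (smt (verit))
      next
        assume "k = 4"
        with spots have "(x, y) \<in> spots m h s (Suc 0)" "(x', y') \<in> spots m h s 5" by simp_all
        then show ?thesis unfolding mem_spots c_def using sum le pos by (smt (verit))
      qed
      then show False using assms(1) by presburger
    qed
  next
    case (ge2 i)
    then show ?case by (metis add_Suc jump_turn_back spots_step)
  qed
qed


section \<open>Moves within a section of the lift\<close>

context split_cycle
begin

lemma induced_path_3: "induced_path r s (a i @ a (Suc i) @ a (Suc (Suc i)))"
  using nonadjacent [of 2 i]
  by (intro induced_path_append path link linked_append2) (simp_all add: numeral_2_eq_2)

lemma induced_path_5: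
  "induced_path r s (a i @ a (Suc i) @ a (Suc (Suc i)) @ a (Suc (Suc (Suc i))) @ a (Suc (Suc (Suc (Suc i)))))"
proof -
  have 2: "apart r s (a i) (a (Suc (Suc i)))" and 3: "apart r s (a i) (a (Suc (Suc (Suc i))))"
    and 4: "apart r s (a i) (a (Suc (Suc (Suc (Suc i)))))" for i
    using nonadjacent [of 2 i] nonadjacent [of 3 i] nonadjacent [of 4 i]
    by (simp_all add: eval_nat_numeral)
  show ?thesis
    by (intro induced_path_append path link linked_append2) (simp_all add: 2 3 4)
qed

text \<open>The instances of \<open>diagonal\<close> needed for the directions E and NE.\<close>

lemma diagonals:
  defines "n \<equiv> m + 2 * h + 1"
  shows "hd (a 3) = last (a 0) + (- n, m)" "hd (a 4) = last (a (Suc 0)) + (- n, - m)"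
    "hd (a 2) = last (a 7) + (- m, n)" "hd (a (Suc 0)) = last (a 6) + (m, n)"
proof -
  have e: "x = y + z" if "x - y = z" for x y z :: square using that by auto
  show "hd (a 3) = last (a 0) + (- n, m)"
    using diagonal [of 0] by (intro e) (simp add: mem_around n_def)
  show "hd (a 4) = last (a (Suc 0)) + (- n, - m)"
    using diagonal [of "Suc 0"] by (intro e) (simp add: mem_around n_def)
  show "hd (a 2) = last (a 7) + (- m, n)"
    using diagonal [of 7] periodic [of 2]
    by (intro e) (simp add: mem_around_numeral n_def quarter_turn_def prod_eq_iff)
  show "hd (a (Suc 0)) = last (a 6) + (m, n)"
    using diagonal [of 6] periodic [of "Suc 0"]
    by (intro e) (simp add: mem_around_numeral n_def quarter_turn_def prod_eq_iff)
qed

lemma lifted_path: "induced_path r s (lifted e m h a i)"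
  using split_cycle_axioms
proof (induction a i rule: split_cycle_turn_induct)
  case (E b)
  then interpret B: split_cycle m h r s b .
  have inj: "inj (\<lambda>z. z + v)" for v :: square by (simp add: inj_def)
  note tr = path_properties_map(1) [OF inj jump_translate]
  show ?case
    using induced_path_rev [OF B.induced_path_3 [of 3]] induced_path_rev [OF B.induced_path_5 [of 2]] B.path [of 0]
    by (cases e) (simp_all add: lifted_def lift_pieces_E_NE_N tr del: lift_pieces.simps map_append)
next
  case (NE b)
  then interpret B: split_cycle m h r s b .
  have inj: "inj (\<lambda>z. z + v)" for v :: square by (simp add: inj_def)
  note tr = path_properties_map(1) [OF inj jump_translate]
  have 8: "b 8 = b 0" "b 9 = b (Suc 0)" "b 10 = b 2" using B.periodic [of 0] B.periodic [of 1] B.periodic [of 2] by simp_all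
  show ?case
    using induced_path_rev [OF B.induced_path_3 [of 4]] B.induced_path_3 [of 8] B.path [of "Suc 0"]
    by (cases e) (simp_all add: lifted_def lift_pieces_E_NE_N tr 8 del: lift_pieces.simps map_append)
next
  case (turn b i)
  then interpret B: split_cycle m h r s b by simp
  show ?case using turn(2) unfolding B.lifted_turned
    by (simp add: turned_def path_properties_map [of turn_back, OF inj_turn_back jump_turn_back])
qed

end


section \<open>Replacing a square by its neighbour\<close>

context split_cycle
begin

lemma mem_set_sector: "(x, y) \<in> set (a i) \<Longrightarrow> (x, y) \<in> sector m h i"
  using in_sector by blast

text \<open>The relations between pieces that are used below, with the indices reduced modulo
  8.\<close>

lemma wrapped:
  "linked r s (a 0) (a (Suc 0))" "linked r s (a (Suc 0)) (a 2)" "linked r s (a 2) (a 3)"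
  "linked r s (a 7) (a 0)"
  "apart r s (a 0) (a 2)" "apart r s (a 0) (a 3)" "apart r s (a 0) (a 4)"
  "apart r s (a (Suc 0)) (a 3)" "apart r s (a (Suc 0)) (a 4)" "apart r s (a 2) (a 4)"
  "apart r s (a 6) (a 0)" "apart r s (a 6) (a (Suc 0))" "apart r s (a 6) (a 2)"
  "apart r s (a 6) (a 3)" "apart r s (a 6) (a 4)"
  "apart r s (a 7) (a (Suc 0))" "apart r s (a 7) (a 2)" "apart r s (a 7) (a 3)" "apart r s (a 7) (a 4)"
proof -
  have p: "a 8 = a 0" "a 9 = a (Suc 0)" "a 10 = a 2" "a 11 = a 3"
    using periodic [of 0] periodic [of 1] periodic [of 2] periodic [of 3] by simp_all
  have l: "linked r s (a i) (a j)" if "j = Suc i" for i j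
    using link that by simp
  show "linked r s (a 0) (a (Suc 0))" "linked r s (a (Suc 0)) (a 2)" "linked r s (a 2) (a 3)"
    by (rule l, simp)+
  show "linked r s (a 7) (a 0)"
    using l [of 8 7] p by simp
  have n: "apart r s (a i) (a j)" if "j = i + 2 \<or> j = i + 3 \<or> j = i + 4" for i j
    using nonadjacent [of 2 i] nonadjacent [of 3 i] nonadjacent [of 4 i] that by auto
  show "apart r s (a 0) (a 2)" "apart r s (a 0) (a 3)" "apart r s (a 0) (a 4)"
    "apart r s (a (Suc 0)) (a 3)" "apart r s (a (Suc 0)) (a 4)" "apart r s (a 2) (a 4)"
    by (rule n, simp)+
  show "apart r s (a 6) (a 0)" "apart r s (a 6) (a (Suc 0))" "apart r s (a 6) (a 2)"
    "apart r s (a 7) (a (Suc 0))" "apart r s (a 7) (a 2)" "apart r s (a 7) (a 3)"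
    using n [of 8 6] n [of 9 6] n [of 10 6] n [of 9 7] n [of 10 7] n [of 11 7] by (simp_all add: p)
  show "apart r s (a 6) (a 3)" "apart r s (a 6) (a 4)" "apart r s (a 7) (a 4)"
    by (rule apart_sym, rule n, simp)+
qed

text \<open>Links between lifted pieces are reduced to links of the given cycle. Instead of
  translating \<open>z\<close> by \<open>u\<close> and \<open>w\<close> by \<open>v\<close>, translate only \<open>z\<close> by \<open>u - v\<close> (or only \<open>w\<close> by \<open>v - u\<close>). In all cases
  below this is a move of the \<open>(m, n)\<close>-leaper, so that the result is again a square of the
  cycle.\<close>

lemma linked_replace_left:
  assumes "linked r s (a k) (a l)" "xs \<noteq> []" "hd ys = hd (a l)" "ys \<noteq> []"
    and last: "last (a k) = last xs + (u - v)"
    and inside: "\<And>z w. z \<in> set xs \<Longrightarrow> w \<in> set ys \<Longrightarrow> jump r s (z + (u - v)) w \<Longrightarrow>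
                   z + (u - v) \<in> set (a k) \<and> w \<in> set (a l)"
  shows "linked r s (map (\<lambda>z. z + u) xs) (map (\<lambda>w. w + v) ys)"
proof (rule linked_translate)
  fix z w assume zw: "z \<in> set xs" "w \<in> set ys"
  have "jump r s (z + u) (w + v) \<longleftrightarrow> jump r s (z + (u - v)) w"
    by (rule jump_diff) (simp add: algebra_simps)
  also have "\<dots> \<longleftrightarrow> z + (u - v) = last (a k) \<and> w = hd (a l)"
    using inside [OF zw] assms(1) nonempty unfolding linked_def by (metis last_in_set hd_in_set)
  finally show "jump r s (z + u) (w + v) \<longleftrightarrow> z = last xs \<and> w = hd ys"
    by (simp add: last assms(3))
qed fact+

lemma linked_replace_right:
  assumes "linked r s (a k) (a l)" "ys \<noteq> []" "last xs = last (a k)" "xs \<noteq> []"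
    and hd: "hd (a l) = hd ys + (v - u)"
    and inside: "\<And>z w. z \<in> set xs \<Longrightarrow> w \<in> set ys \<Longrightarrow> jump r s z (w + (v - u)) \<Longrightarrow>
                   z \<in> set (a k) \<and> w + (v - u) \<in> set (a l)"
  shows "linked r s (map (\<lambda>z. z + u) xs) (map (\<lambda>w. w + v) ys)"
proof (rule linked_translate)
  fix z w assume zw: "z \<in> set xs" "w \<in> set ys"
  have "jump r s (z + u) (w + v) \<longleftrightarrow> jump r s z (w + (v - u))"
    by (rule jump_diff) (simp add: algebra_simps)
  also have "\<dots> \<longleftrightarrow> z = last (a k) \<and> w + (v - u) = hd (a l)"
    using inside [OF zw] assms(1) nonempty unfolding linked_def by (metis last_in_set hd_in_set)
  finally show "jump r s (z + u) (w + v) \<longleftrightarrow> z = last xs \<and> w = hd ys"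
    by (simp add: hd assms(3))
qed fact+

lemma closed_coordinates:
  assumes "(x, y) \<in> squares a" "\<bar>x'\<bar> \<le> m + h" "\<bar>y'\<bar> \<le> m + h"
    and "\<bar>x' - x\<bar> = m + 2 * h + 1 \<and> \<bar>y' - y\<bar> = m \<or> \<bar>x' - x\<bar> = m \<and> \<bar>y' - y\<bar> = m + 2 * h + 1"
  shows "(x', y') \<in> squares a"
  using closed [OF assms(1), of "(x', y')"] assms(2-4) by (auto simp: jump_def)

lemma jump_coordinates:
  assumes "jump r s (x, y) (x', y')"
  shows "\<bar>x' - x\<bar> \<le> s" "\<bar>y' - y\<bar> \<le> s"
  using jump_bound [OF assms params(3)] by simp_all

text \<open>The six lemmas that follow, one for each type of lift and each of the directions E and
  NE, verify the remaining hypothesis of the reduction: when the translates of \<open>z\<close> and \<open>w\<close> are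
  joined by a move, the translated square stays on the board, hence in the cycle by \<open>closed\<close>, and
  belongs to the right piece.\<close>

lemma replaced_F_E:
  assumes z: "(x, y) \<in> set (a 3) \<union> set (a 4) \<union> set (a 5)"
    and w: "(x', y') \<in> set (a (Suc 0))"
    and j: "jump r s ((x, y) + (m + 2 * h + 1, - m)) (x', y')"
  shows "(x, y) + (m + 2 * h + 1, - m) \<in> set (a 0) \<and> (x', y') \<in> set (a (Suc 0))"
proof -
  have zb: "x < - h \<and> - (m + h) \<le> x \<and> \<bar>y\<bar> \<le> m + h"
    using z params by (auto simp: mem_sector dest!: mem_set_sector)
  have wb: "h < x' \<and> h < y'"
    using w params by (auto simp: mem_sector dest!: mem_set_sector)
  have j: "jump r s (x + (m + 2 * h + 1), y + (- m)) (x', y')" using j by simp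
  \<comment> \<open>A move spans at most \<open>s\<close>, and \<open>s \<le> m\<close>; this keeps the replaced square on the board.\<close>
  have b: "h < y" using jump_coordinates [OF j] zb wb params by linarith
  have "(x, y) \<in> squares a" using z by (auto simp: squares_def)
  then have "(x + (m + 2 * h + 1), y + (- m)) \<in> squares a"
    by (rule closed_coordinates) (use zb wb b params in linarith)+
  then have "(x + (m + 2 * h + 1), y + (- m)) \<in> set (a 0) \<union> set (a 7)"
  proof (cases rule: squares_cases)
    case E
    then show ?thesis by simp
  next
    case SE
    then show ?thesis by simp
  qed (use zb wb b params in linarith)+
  then show ?thesis using w j wrapped by (auto simp: apart_def jump_sym)
qed

lemma replaced_F_NE:
  assumes z: "(x, y) \<in> set (a (Suc 0))"
    and w: "(x', y') \<in> set (a 5) \<union> set (a 6) \<union> set (a 7)"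
    and j: "jump r s (x, y) ((x', y') + (- m, m + 2 * h + 1))"
  shows "(x, y) \<in> set (a (Suc 0)) \<and> (x', y') + (- m, m + 2 * h + 1) \<in> set (a 2)"
proof -
  have zb: "h < x \<and> h < y"
    using z params by (auto simp: mem_sector dest!: mem_set_sector)
  have wb: "y' < - h \<and> - (m + h) \<le> y' \<and> \<bar>x'\<bar> \<le> m + h"
    using w params by (auto simp: mem_sector dest!: mem_set_sector)
  have j: "jump r s (x, y) (x' + (- m), y' + (m + 2 * h + 1))" using j by simp
  have b: "h < x'" using jump_coordinates [OF j] zb wb params by linarith
  have "(x', y') \<in> squares a" using w by (auto simp: squares_def)
  then have "(x' + (- m), y' + (m + 2 * h + 1)) \<in> squares a"
    by (rule closed_coordinates) (use zb wb b params in linarith)+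
  then have "(x' + (- m), y' + (m + 2 * h + 1)) \<in> set (a 2) \<union> set (a 3)"
  proof (cases rule: squares_cases)
    case N
    then show ?thesis by simp
  next
    case NW
    then show ?thesis by simp
  qed (use zb wb b params in linarith)+
  then show ?thesis using z j wrapped by (auto simp: apart_def jump_sym)
qed

lemma replaced_G_E:
  assumes z: "(x, y) \<in> set (a 0)"
    and w: "(x', y') \<in> set (a 4) \<union> set (a 5) \<union> set (a 6)"
    and j: "jump r s (x, y) ((x', y') + (m, m + 2 * h + 1))"
  shows "(x, y) \<in> set (a 0) \<and> (x', y') + (m, m + 2 * h + 1) \<in> set (a (Suc 0))"
proof -
  have zb: "y \<le> h"
    using z params by (auto simp: mem_sector dest!: mem_set_sector)
  have wb: "- (m + h) \<le> x' \<and> x' \<le> h \<and> - (m + h) \<le> y' \<and> y' \<le> h"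
    using w params by (auto simp: mem_sector dest!: mem_set_sector)
  have j: "jump r s (x, y) (x' + (m), y' + (m + 2 * h + 1))" using j by simp
  have b: "y' < - h" using jump_coordinates [OF j] zb wb params by linarith
  have "(x', y') \<in> squares a" using w by (auto simp: squares_def)
  then have "(x' + (m), y' + (m + 2 * h + 1)) \<in> squares a"
    by (rule closed_coordinates) (use zb wb b params in linarith)+
  then have "(x' + (m), y' + (m + 2 * h + 1)) \<in> set (a (Suc 0)) \<union> set (a 2)"
  proof (cases rule: squares_cases)
    case NE
    then show ?thesis by simp
  next
    case N
    then show ?thesis by simp
  qed (use zb wb b params in linarith)+
  then show ?thesis using z j wrapped by (auto simp: apart_def jump_sym)
qed

lemma replaced_G_NE:
  assumes z: "(x, y) \<in> set (a 4) \<union> set (a 5) \<union> set (a 6)"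
    and w: "(x', y') \<in> set (a 2)"
    and j: "jump r s ((x, y) + (m + 2 * h + 1, m)) (x', y')"
  shows "(x, y) + (m + 2 * h + 1, m) \<in> set (a (Suc 0)) \<and> (x', y') \<in> set (a 2)"
proof -
  have zb: "- (m + h) \<le> x \<and> x \<le> h \<and> - (m + h) \<le> y \<and> y \<le> h"
    using z params by (auto simp: mem_sector dest!: mem_set_sector)
  have wb: "x' \<le> h"
    using w params by (auto simp: mem_sector dest!: mem_set_sector)
  have j: "jump r s (x + (m + 2 * h + 1), y + (m)) (x', y')" using j by simp
  have b: "x < - h" using jump_coordinates [OF j] zb wb params by linarith
  have "(x, y) \<in> squares a" using z by (auto simp: squares_def)
  then have "(x + (m + 2 * h + 1), y + (m)) \<in> squares a"
    by (rule closed_coordinates) (use zb wb b params in linarith)+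
  then have "(x + (m + 2 * h + 1), y + (m)) \<in> set (a 0) \<union> set (a (Suc 0))"
  proof (cases rule: squares_cases)
    case E
    then show ?thesis by simp
  next
    case NE
    then show ?thesis by simp
  qed (use zb wb b params in linarith)+
  then show ?thesis using w j wrapped by (auto simp: apart_def jump_sym)
qed

lemma replaced_H_E:
  assumes z: "(x, y) \<in> set (a 2) \<union> set (a 3) \<union> set (a 4) \<union> set (a 5) \<union> set (a 6)"
    and w: "(x', y') \<in> set (a 0) \<union> set (a (Suc 0)) \<union> set (a 2)"
    and j: "jump r s ((x, y) + (m, - (m + 2 * h + 1))) (x', y')"
  shows "(x, y) + (m, - (m + 2 * h + 1)) \<in> set (a 7) \<and> (x', y') \<in> set (a 0)"
proof -
  have zb: "- (m + h) \<le> x \<and> x \<le> h \<and> \<bar>y\<bar> \<le> m + h"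
    using z params by (auto simp: mem_sector dest!: mem_set_sector)
  have wb: "- h \<le> y'"
    using w params by (auto simp: mem_sector dest!: mem_set_sector)
  have j: "jump r s (x + (m), y + (- (m + 2 * h + 1))) (x', y')" using j by simp
  have b: "h < y" using jump_coordinates [OF j] zb wb params by linarith
  have "(x, y) \<in> squares a" using z by (auto simp: squares_def)
  then have "(x + (m), y + (- (m + 2 * h + 1))) \<in> squares a"
    by (rule closed_coordinates) (use zb wb b params in linarith)+
  then have "(x + (m), y + (- (m + 2 * h + 1))) \<in> set (a 6) \<union> set (a 7)"
  proof (cases rule: squares_cases)
    case S
    then show ?thesis by simp
  next
    case SE
    then show ?thesis by simp
  qed (use zb wb b params in linarith)+
  then show ?thesis using w j wrapped by (auto simp: apart_def jump_sym)
qed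

lemma replaced_H_NE:
  assumes z: "(x, y) \<in> set (a 0) \<union> set (a (Suc 0)) \<union> set (a 2)"
    and w: "(x', y') \<in> set (a 0) \<union> set (a 7) \<union> set (a 6) \<union> set (a 5) \<union> set (a 4)"
    and j: "jump r s (x, y) ((x', y') + (- (m + 2 * h + 1), m))"
  shows "(x, y) \<in> set (a 2) \<and> (x', y') + (- (m + 2 * h + 1), m) \<in> set (a 3)"
proof -
  have zb: "- h \<le> x"
    using z params by (auto simp: mem_sector dest!: mem_set_sector)
  have wb: "- (m + h) \<le> y' \<and> y' \<le> h \<and> \<bar>x'\<bar> \<le> m + h"
    using w params by (auto simp: mem_sector dest!: mem_set_sector)
  have j: "jump r s (x, y) (x' + (- (m + 2 * h + 1)), y' + (m))" using j by simp
  have b: "h < x'" using jump_coordinates [OF j] zb wb params by linarith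
  have "(x', y') \<in> squares a" using w by (auto simp: squares_def)
  then have "(x' + (- (m + 2 * h + 1)), y' + (m)) \<in> squares a"
    by (rule closed_coordinates) (use zb wb b params in linarith)+
  then have "(x' + (- (m + 2 * h + 1)), y' + (m)) \<in> set (a 3) \<union> set (a 4)"
  proof (cases rule: squares_cases)
    case NW
    then show ?thesis by simp
  next
    case W
    then show ?thesis by simp
  qed (use zb wb b params in linarith)+
  then show ?thesis using z j wrapped by (auto simp: apart_def jump_sym)
qed

end


section \<open>Links and diagonals of the lift\<close>

context split_cycle
begin

lemma shift_values:
  "shift F m h 0 = (2 * m + 2 * h + 1, 0)" "shift F m h (Suc 0) = (m, m)"
  "shift F m h 2 = (0, 2 * m + 2 * h + 1)"
  "shift G m h 0 = (2 * h + 1, 0)" "shift G m h (Suc 0) = (m + 2 * h + 1, m + 2 * h + 1)"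
  "shift G m h 2 = (0, 2 * h + 1)"
  "shift H m h 0 = (2 * m + 2 * h + 1, 0)" "shift H m h (Suc 0) = (m + 2 * h + 1, m + 2 * h + 1)"
  "shift H m h 2 = (0, 2 * m + 2 * h + 1)"
  by (simp_all add: shift_def Let_def)

lemma lifted_link_E: "linked r s (lifted e m h a 0) (lifted e m h a (Suc 0))"
proof (cases e)
  case F
  show ?thesis unfolding F lifted_def lift_pieces_E_NE_N shift_values
  proof (rule linked_replace_left [OF wrapped(1)])
    fix z w assume "z \<in> set (rev (a 5) @ rev (a 4) @ rev (a 3))"
      "w \<in> set (a (Suc 0))"
      "jump r s (z + ((2 * m + 2 * h + 1, 0) - (m, m))) w"
    then show "z + ((2 * m + 2 * h + 1, 0) - (m, m)) \<in> set (a 0) \<and> w \<in> set (a (Suc 0))"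
      using replaced_F_E [of "fst z" "snd z" "fst w" "snd w"] by (auto simp: algebra_simps)
  qed (simp_all add: last_rev diagonals prod_eq_iff)
next
  case G
  show ?thesis unfolding G lifted_def lift_pieces_E_NE_N shift_values
  proof (rule linked_replace_right [OF wrapped(1)])
    fix z w assume "z \<in> set (a 0)"
      "w \<in> set (rev (a 6) @ rev (a 5) @ rev (a 4))"
      "jump r s z (w + ((m + 2 * h + 1, m + 2 * h + 1) - (2 * h + 1, 0)))"
    then show "z \<in> set (a 0) \<and> w + ((m + 2 * h + 1, m + 2 * h + 1) - (2 * h + 1, 0)) \<in> set (a (Suc 0))"
      using replaced_G_E [of "fst z" "snd z" "fst w" "snd w"] by (auto simp: algebra_simps)
  qed (simp_all add: hd_rev diagonals prod_eq_iff)
next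
  case H
  show ?thesis unfolding H lifted_def lift_pieces_E_NE_N shift_values
  proof (rule linked_replace_left [OF wrapped(4)])
    fix z w assume "z \<in> set (rev (a 6) @ rev (a 5) @ rev (a 4) @ rev (a 3) @ rev (a 2))"
      "w \<in> set (a 0 @ a (Suc 0) @ a 2)"
      "jump r s (z + ((2 * m + 2 * h + 1, 0) - (m + 2 * h + 1, m + 2 * h + 1))) w"
    then show "z + ((2 * m + 2 * h + 1, 0) - (m + 2 * h + 1, m + 2 * h + 1)) \<in> set (a 7) \<and> w \<in> set (a 0)"
      using replaced_H_E [of "fst z" "snd z" "fst w" "snd w"] by (auto simp: algebra_simps)
  qed (simp_all add: last_rev diagonals prod_eq_iff)
qed

lemma lifted_link_NE: "linked r s (lifted e m h a (Suc 0)) (lifted e m h a 2)"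
proof (cases e)
  case F
  show ?thesis unfolding F lifted_def lift_pieces_E_NE_N shift_values
  proof (rule linked_replace_right [OF wrapped(2)])
    fix z w assume "z \<in> set (a (Suc 0))"
      "w \<in> set (rev (a 7) @ rev (a 6) @ rev (a 5))"
      "jump r s z (w + ((0, 2 * m + 2 * h + 1) - (m, m)))"
    then show "z \<in> set (a (Suc 0)) \<and> w + ((0, 2 * m + 2 * h + 1) - (m, m)) \<in> set (a 2)"
      using replaced_F_NE [of "fst z" "snd z" "fst w" "snd w"] by (auto simp: algebra_simps)
  qed (simp_all add: hd_rev diagonals prod_eq_iff)
next
  case G
  show ?thesis unfolding G lifted_def lift_pieces_E_NE_N shift_values
  proof (rule linked_replace_left [OF wrapped(2)])
    fix z w assume "z \<in> set (rev (a 6) @ rev (a 5) @ rev (a 4))"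
      "w \<in> set (a 2)"
      "jump r s (z + ((m + 2 * h + 1, m + 2 * h + 1) - (0, 2 * h + 1))) w"
    then show "z + ((m + 2 * h + 1, m + 2 * h + 1) - (0, 2 * h + 1)) \<in> set (a (Suc 0)) \<and> w \<in> set (a 2)"
      using replaced_G_NE [of "fst z" "snd z" "fst w" "snd w"] by (auto simp: algebra_simps)
  qed (simp_all add: last_rev diagonals prod_eq_iff)
next
  case H
  show ?thesis unfolding H lifted_def lift_pieces_E_NE_N shift_values
  proof (rule linked_replace_right [OF wrapped(3)])
    fix z w assume "z \<in> set (a 0 @ a (Suc 0) @ a 2)"
      "w \<in> set (rev (a 0) @ rev (a 7) @ rev (a 6) @ rev (a 5) @ rev (a 4))"
      "jump r s z (w + ((0, 2 * m + 2 * h + 1) - (m + 2 * h + 1, m + 2 * h + 1)))"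
    then show "z \<in> set (a 2) \<and> w + ((0, 2 * m + 2 * h + 1) - (m + 2 * h + 1, m + 2 * h + 1)) \<in> set (a 3)"
      using replaced_H_NE [of "fst z" "snd z" "fst w" "snd w"] by (auto simp: algebra_simps)
  qed (simp_all add: hd_rev diagonals prod_eq_iff)
qed

lemma lifted_link: "linked r s (lifted e m h a i) (lifted e m h a (Suc i))"
  using split_cycle_axioms
proof (induction a i rule: split_cycle_turn_induct)
  case (E b)
  then show ?case by (rule split_cycle.lifted_link_E)
next
  case (NE b)
  then show ?case using split_cycle.lifted_link_NE [OF NE] by (simp add: numeral_2_eq_2)
next
  case (turn b i)
  then interpret B: split_cycle m h r s b by simp
  show ?case using turn(2) unfolding B.lifted_turned
    by (simp add: turned_def path_properties_map [of turn_back, OF inj_turn_back jump_turn_back])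
qed

lemma lifted_diagonal:
  "hd (lifted e m h a (i + 3)) - last (lifted e m h a i) \<in>
     around {(- (lift_m e m h + 2 * lift_h e m h + 1), lift_m e m h)}
            {(- (lift_m e m h + 2 * lift_h e m h + 1), - lift_m e m h)} i"
  using split_cycle_axioms
proof (induction a i rule: split_cycle_turn_induct)
  case (E b)
  then interpret B: split_cycle m h r s b .
  have "hd (lift_pieces e b 3) = hd (case e of F \<Rightarrow> b 3 | G \<Rightarrow> rev (b 0) | H \<Rightarrow> b 2)"
    by (cases e) (simp_all add: hd_append)
  moreover have "last (lift_pieces e b 0) = last (case e of F \<Rightarrow> rev (b 3) | G \<Rightarrow> b 0 | H \<Rightarrow> rev (b 2))"
    by (cases e) (simp_all add: lift_pieces_E_NE_N del: lift_pieces.simps)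
  ultimately show ?case
    by (cases e) (simp_all add: lifted_def hd_map last_map hd_rev last_rev mem_around lift_m_def lift_h_def
        shift_def Let_def prod_eq_iff del: lift_pieces.simps)
next
  case (NE b)
  then interpret B: split_cycle m h r s b .
  have "hd (lift_pieces e b 4) = hd (case e of F \<Rightarrow> rev (b (Suc 0)) | G \<Rightarrow> b 4 | H \<Rightarrow> rev (b 2))"
    by (cases e) (simp_all add: hd_append)
  moreover have "last (lift_pieces e b (Suc 0)) = last (case e of F \<Rightarrow> b (Suc 0) | G \<Rightarrow> rev (b 4) | H \<Rightarrow> b 2)"
    by (cases e) (simp_all add: lift_pieces_E_NE_N del: lift_pieces.simps)
  ultimately show ?case
    by (cases e) (simp_all add: lifted_def hd_map last_map hd_rev last_rev mem_around lift_m_def lift_h_def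
        shift_def Let_def prod_eq_iff del: lift_pieces.simps)
next
  case (turn b i)
  then interpret B: split_cycle m h r s b by simp
  show ?case using turn(2) unfolding B.lifted_turned
    by (simp add: turned_def hd_map last_map mem_around turn_back_diff)
qed

text \<open>Under a lift of type \<open>G\<close> the center \<open>t\<close> stays and the position \<open>k\<close> on the axis grows by
  \<open>2 h + 1\<close>. The piece of a diagonal direction arises from the opposite corner of the frame and
  the two sections next to it, moved across the hole. This exchanges the two kinds of squares,
  and the points on the axes become squares of the second kind.\<close>

lemma lifted_spread_G:
  assumes "\<forall>i. \<forall>z\<in>set (a i). z - t \<in> spots m h s i"
  shows "z \<in> set (lifted G m h a i) \<Longrightarrow> z - t \<in> spots (m + 2 * h + 1) h s i"
  using split_cycle_axioms assms
proof (induction a i arbitrary: z t rule: split_cycle_turn_induct)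
  case (E b)
  then obtain w where w: "w \<in> set (b 0)" "z = w + (2 * h + 1, 0)"
    by (auto simp: lifted_def shift_values lift_pieces_E_NE_N simp del: lift_pieces.simps)
  obtain x y where xy: "w - t = (x, y)" by force
  then have "z - t = (x + (2 * h + 1), y)" unfolding w by (simp add: prod_eq_iff)
  moreover have "(x, y) \<in> spots m h s 0" using E(3) w(1) xy by metis
  ultimately show ?case by (simp add: mem_spots)
next
  case (NE b)
  then obtain j w where w: "w \<in> set (b j)" "z = w + (m + 2 * h + 1, m + 2 * h + 1)" "j = 4 \<or> j = 5 \<or> j = 6"
    by (auto simp: lifted_def shift_values lift_pieces_E_NE_N simp del: lift_pieces.simps)
  obtain x y where xy: "w - t = (x, y)" by force
  then have "z - t = (x + (m + 2 * h + 1), y + (m + 2 * h + 1))" unfolding w by (simp add: prod_eq_iff)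
  moreover have "(x, y) \<in> spots m h s j" using NE(3) w(1) xy by metis
  ultimately show ?case using w(3) params by (auto simp: mem_spots)
next
  case (turn b i)
  then interpret B: split_cycle m h r s b by simp
  have "turn_back z - turn_back t \<in> spots (m + 2 * h + 1) h s i"
  proof (rule turn(2))
    show "turn_back z \<in> set (lifted G m h (turned b) i)"
      using turn(3) unfolding B.lifted_turned by (auto simp: turned_def)
    show "\<forall>i. \<forall>z\<in>set (turned b i). z - turn_back t \<in> spots m h s i"
      using turn(4) by (force simp: turned_def turn_back_diff [symmetric] spots_step [symmetric])
  qed
  then show ?case by (simp add: spots_step turn_back_diff)
qed

lemma lifted_spread:
  "s \<le> 2 * lift_h e m h + 1 \<or>
   (\<exists>t. \<forall>i. \<forall>z\<in>set (lifted e m h a i). z - t \<in> spots (lift_m e m h) (lift_h e m h) s i)"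
proof (cases e)
  case G
  show ?thesis
    using spread lifted_spread_G unfolding G lift_m_def lift_h_def lift_type.case by blast
qed (use params in \<open>auto simp: lift_h_def\<close>)

end


section \<open>Sections of the lift that are not adjacent\<close>

context split_cycle
begin

lemma mem_lifted_sector:
  "(x, y) \<in> set (lifted e m h a i) \<Longrightarrow> (x, y) \<in> sector (lift_m e m h) (lift_h e m h) i"
  by (simp add: mem_set_lifted)

text \<open>The lifted pieces of E and N are not separated by the hole under lifts of types \<open>F\<close> and \<open>H\<close>.
  Here both squares are replaced by neighbours in the graph of the \<open>(m, n)\<close>-leaper, and these lie
  in sections of the given frame that are not adjacent.\<close>

lemma replaced_F_E_N:
  assumes z: "(x, y) \<in> set (a 3) \<union> set (a 4) \<union> set (a 5)"
    and w: "(x', y') \<in> set (a 5) \<union> set (a 6) \<union> set (a 7)"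
  shows "\<not> jump r s (x + (2 * m + 2 * h + 1), y) (x', y' + (2 * m + 2 * h + 1))"
proof
  assume j: "jump r s (x + (2 * m + 2 * h + 1), y) (x', y' + (2 * m + 2 * h + 1))"
  have zb: "x < - h \<and> - (m + h) \<le> x \<and> \<bar>y\<bar> \<le> m + h"
    using z params by (auto simp: mem_sector dest!: mem_set_sector)
  have wb: "y' < - h \<and> - (m + h) \<le> y' \<and> \<bar>x'\<bar> \<le> m + h"
    using w params by (auto simp: mem_sector dest!: mem_set_sector)
  have b: "h < y" "h < x'"
    using jump_coordinates [OF j] zb wb params by linarith+
  have "(x, y) \<in> squares a" using z by (auto simp: squares_def)
  then have "(x + (m + 2 * h + 1), y - m) \<in> squares a"
    by (rule closed_coordinates) (use zb wb b params in linarith)+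
  then have "(x + (m + 2 * h + 1), y - m) \<in> set (a 0) \<union> set (a 7)"
  proof (cases rule: squares_cases)
    case E
    then show ?thesis by simp
  next
    case SE
    then show ?thesis by simp
  qed (use zb wb b params in linarith)+
  moreover have "(x', y') \<in> squares a" using w by (auto simp: squares_def)
  then have "(x' - m, y' + (m + 2 * h + 1)) \<in> squares a"
    by (rule closed_coordinates) (use zb wb b params in linarith)+
  then have "(x' - m, y' + (m + 2 * h + 1)) \<in> set (a 2) \<union> set (a 3)"
  proof (cases rule: squares_cases)
    case N
    then show ?thesis by simp
  next
    case NW
    then show ?thesis by simp
  qed (use zb wb b params in linarith)+
  moreover have "jump r s (x + (m + 2 * h + 1), y - m) (x' - m, y' + (m + 2 * h + 1))"
    using j by (simp add: jump_def algebra_simps)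
  ultimately show False using wrapped by (auto simp: apart_def jump_sym)
qed

lemma replaced_H_E_N:
  assumes z: "(x, y) \<in> set (a 2) \<union> set (a 3) \<union> set (a 4) \<union> set (a 5) \<union> set (a 6)"
    and w: "(x', y') \<in> set (a 4) \<union> set (a 5) \<union> set (a 6) \<union> set (a 7) \<union> set (a 0)"
  shows "\<not> jump r s (x + (2 * m + 2 * h + 1), y) (x', y' + (2 * m + 2 * h + 1))"
proof
  assume j: "jump r s (x + (2 * m + 2 * h + 1), y) (x', y' + (2 * m + 2 * h + 1))"
  have zb: "x \<le> h \<and> - (m + h) \<le> x \<and> \<bar>y\<bar> \<le> m + h"
    using z params by (auto simp: mem_sector dest!: mem_set_sector)
  have wb: "y' \<le> h \<and> - (m + h) \<le> y' \<and> \<bar>x'\<bar> \<le> m + h"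
    using w params by (auto simp: mem_sector dest!: mem_set_sector)
  have b: "h < y" "h < x'"
    using jump_coordinates [OF j] zb wb params by linarith+
  have "(x, y) \<in> squares a" using z by (auto simp: squares_def)
  then have "(x + m, y - (m + 2 * h + 1)) \<in> squares a"
    by (rule closed_coordinates) (use zb wb b params in linarith)+
  then have "(x + m, y - (m + 2 * h + 1)) \<in> set (a 6) \<union> set (a 7)"
  proof (cases rule: squares_cases)
    case S
    then show ?thesis by simp
  next
    case SE
    then show ?thesis by simp
  qed (use zb wb b params in linarith)+
  moreover have "(x', y') \<in> squares a" using w by (auto simp: squares_def)
  then have "(x' - (m + 2 * h + 1), y' + m) \<in> squares a"
    by (rule closed_coordinates) (use zb wb b params in linarith)+
  then have "(x' - (m + 2 * h + 1), y' + m) \<in> set (a 3) \<union> set (a 4)"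
  proof (cases rule: squares_cases)
    case NW
    then show ?thesis by simp
  next
    case W
    then show ?thesis by simp
  qed (use zb wb b params in linarith)+
  moreover have "jump r s (x + m, y - (m + 2 * h + 1)) (x' - (m + 2 * h + 1), y' + m)"
    using j by (simp add: jump_def algebra_simps)
  ultimately show False using wrapped by (auto simp: apart_def jump_sym)
qed

lemma lifted_apart_E_N:
  assumes "s \<le> 2 * lift_h e m h + 1"
  shows "apart r s (lifted e m h a 0) (lifted e m h a 2)"
proof (cases e)
  case F
  show ?thesis unfolding F apart_def lifted_def lift_pieces_E_NE_N shift_values
    using replaced_F_E_N by auto
next
  case G
  have "\<not> jump r s (x + (2 * h + 1), y) (x', y' + (2 * h + 1))"
    if "(x, y) \<in> set (a 0)" "(x', y') \<in> set (a 2)" for x y x' y'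
    using jump_coordinates [of "x + (2 * h + 1)" y x' "y' + (2 * h + 1)"] assms
      mem_set_sector [OF that(1)] mem_set_sector [OF that(2)]
    unfolding mem_sector G lift_h_def lift_type.case by linarith
  then show ?thesis unfolding G apart_def lifted_def lift_pieces_E_NE_N shift_values by auto
next
  case H
  show ?thesis unfolding H apart_def lifted_def lift_pieces_E_NE_N shift_values
    using replaced_H_E_N by auto
qed

text \<open>A wide hole separates the sections named here by more than \<open>s\<close> in some
  coordinate.\<close>

lemma separated:
  assumes "s \<le> 2 * h' + 1" "(x, y) \<in> sector m' h' i" "(x', y') \<in> sector m' h' j"
    and "i = 0 \<and> (j = 3 \<or> j = 4) \<or> i = Suc 0 \<and> (j = 3 \<or> j = 4 \<or> j = 5)"
  shows "\<not> jump r s (x, y) (x', y')"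
  using jump_coordinates [of x y x' y'] assms by (auto simp: mem_sector)

lemma lifted_apart_small:
  assumes "s \<le> 2 * lift_h e m h + 1" "k = 2 \<or> k = 3 \<or> k = 4"
  shows "apart r s (lifted e m h a i) (lifted e m h a (i + k))"
  using split_cycle_axioms
proof (induction a i rule: split_cycle_turn_induct)
  case (E b)
  then interpret B: split_cycle m h r s b .
  have "apart r s (lifted e m h b 0) (lifted e m h b k)" if "k = 3 \<or> k = 4"
    using B.separated [OF assms(1) B.mem_lifted_sector B.mem_lifted_sector, of _ _ 0 _ _ k] that
    by (auto simp: apart_def)
  then show ?case using B.lifted_apart_E_N [OF assms(1)] assms(2) by auto
next
  case (NE b)
  then interpret B: split_cycle m h r s b .
  have "Suc 0 + k = 3 \<or> Suc 0 + k = 4 \<or> Suc 0 + k = 5" using assms(2) by auto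
  then show ?case
    using B.separated [OF assms(1) B.mem_lifted_sector B.mem_lifted_sector, of _ _ "Suc 0" _ _ "Suc 0 + k"]
    by (auto simp: apart_def)
next
  case (turn b i)
  then interpret B: split_cycle m h r s b by simp
  show ?case using turn(2) unfolding B.lifted_turned
    by (simp add: turned_def path_properties_map [of turn_back, OF inj_turn_back jump_turn_back])
qed

lemma lifted_params: "0 \<le> lift_h e m h" "s \<le> lift_m e m h"
  using params by (cases e; simp add: lift_h_def lift_m_def)+

lemma lifted_apart:
  assumes "k \<in> {2, 3, 4}"
  shows "apart r s (lifted e m h a i) (lifted e m h a (i + k))"
proof (cases "s \<le> 2 * lift_h e m h + 1")
  case True
  then show ?thesis using lifted_apart_small assms by simp
next
  case False
  then obtain t where t: "\<And>i z. z \<in> set (lifted e m h a i) \<Longrightarrow> z - t \<in> spots (lift_m e m h) (lift_h e m h) s i"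
    using lifted_spread [of e] by blast
  show ?thesis unfolding apart_def
  proof (intro ballI notI)
    fix z w assume zw: "z \<in> set (lifted e m h a i)" "w \<in> set (lifted e m h a (i + k))" and "jump r s z w"
    then have "jump r s (z - t) (w - t)" using jump_diff [of "w - t" "z - t" w z] by simp
    then show False
      using spots_no_jump [OF params(5) params(2,3) lifted_params(2,1) assms t [OF zw(1)] t [OF zw(2)]] by simp
  qed
qed


section \<open>Closedness of the lift\<close>

text \<open>To show that a neighbour of a square of the lift belongs to the lift, it is traced back
  along the translation of its own section. This leads either to the square from which the given
  one arose, or to a neighbour of that square.\<close>

lemma squares_liftedI:
  assumes "(u, v) \<in> squares a" "(x, y) = (u, v) + shift e m h i"
    and "(x, y) \<in> sector (lift_m e m h) (lift_h e m h) i"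
  shows "(x, y) \<in> squares (lifted e m h a)"
proof -
  have "(x, y) - shift e m h i = (u, v)" using assms(2) by simp
  then have "(x, y) \<in> set (lifted e m h a i)" unfolding mem_set_lifted using assms(1,3) by simp
  then show ?thesis by (auto simp: squares_def)
qed

lemma squares_lifted_moveI:
  assumes "(u, v) \<in> squares a" "(x, y) = (u', v') + shift e m h i"
    and "(x, y) \<in> sector (lift_m e m h) (lift_h e m h) i"
    and "\<bar>u'\<bar> \<le> m + h" "\<bar>v'\<bar> \<le> m + h"
    and "\<bar>u' - u\<bar> = m + 2 * h + 1 \<and> \<bar>v' - v\<bar> = m \<or> \<bar>u' - u\<bar> = m \<and> \<bar>v' - v\<bar> = m + 2 * h + 1"
  shows "(x, y) \<in> squares (lifted e m h a)"
  using closed_coordinates [OF assms(1,4-6)] assms(2,3) by (rule squares_liftedI)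

text \<open>The case distinction is over the few moves of the lifted leaper that stay on the board
  and over the section in which they end.\<close>

lemma lifted_closed_F_E:
  assumes S: "(x, y) \<in> squares a"
    and sec: "(x, y) + shift F m h 0 \<in> sector (lift_m F m h) (lift_h F m h) 0"
    and j: "jump (lift_m F m h) (lift_m F m h + 2 * lift_h F m h + 1) ((x, y) + shift F m h 0) (x', y')"
    and b: "\<bar>x'\<bar> \<le> lift_m F m h + lift_h F m h" "\<bar>y'\<bar> \<le> lift_m F m h + lift_h F m h"
  shows "(x', y') \<in> squares (lifted F m h a)"
proof -
  note defs = lift_m_def lift_h_def lift_type.case
  have sq: "\<bar>x\<bar> \<le> m + h" "\<bar>y\<bar> \<le> m + h"
    using S params by (cases rule: squares_cases; simp)+
  have zb: "- (m + h) \<le> x \<and> x < - h"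
    using sec params unfolding shift_values add_Pair mem_sector defs by ((intro conjI)?; linarith)
  have "x' = x - m \<and> y' = y + m \<or> x' = x - m \<and> y' = y - m"
    using j b zb sq params unfolding shift_values add_Pair jump_def defs fst_conv snd_conv by (smt (verit))
  then show ?thesis
  proof (elim disjE)
    assume e: "x' = x - m \<and> y' = y + m"
    show ?thesis
    proof (cases "h < y")
      case True
      show ?thesis
        by (rule squares_liftedI [OF S, of _ _ _ 3], use e in \<open>simp add: shift_def Let_def\<close>,
            unfold mem_sector defs, intro conjI; use e True zb sq b params in linarith)
    next
      case False
      show ?thesis
        by (rule squares_lifted_moveI [OF S, of _ _ "x + (m + 2 * h + 1)" "y + m" _ 4],
            use e in \<open>simp add: shift_def Let_def\<close>,
            unfold mem_sector defs, (intro conjI)?; use e False zb sq b params in linarith)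
    qed
  next
    assume e: "x' = x - m \<and> y' = y - m"
    show ?thesis
    proof (cases "y < - h")
      case True
      show ?thesis
        by (rule squares_liftedI [OF S, of _ _ _ 5], use e in \<open>simp add: shift_def Let_def\<close>,
            unfold mem_sector defs, intro conjI; use e True zb sq b params in linarith)
    next
      case False
      show ?thesis
        by (rule squares_lifted_moveI [OF S, of _ _ "x + (m + 2 * h + 1)" "y - m" _ 4],
            use e in \<open>simp add: shift_def Let_def\<close>,
            unfold mem_sector defs, (intro conjI)?; use e False zb sq b params in linarith)
    qed
  qed
qed

lemma lifted_closed_F_NE:
  assumes S: "(x, y) \<in> squares a"
    and sec: "(x, y) + shift F m h (Suc 0) \<in> sector (lift_m F m h) (lift_h F m h) (Suc 0)"
    and j: "jump (lift_m F m h) (lift_m F m h + 2 * lift_h F m h + 1) ((x, y) + shift F m h (Suc 0)) (x', y')"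
    and b: "\<bar>x'\<bar> \<le> lift_m F m h + lift_h F m h" "\<bar>y'\<bar> \<le> lift_m F m h + lift_h F m h"
  shows "(x', y') \<in> squares (lifted F m h a)"
proof -
  note defs = lift_m_def lift_h_def lift_type.case
  have sq: "\<bar>x\<bar> \<le> m + h" "\<bar>y\<bar> \<le> m + h"
    using S params by (cases rule: squares_cases; simp)+
  have zb: "h < x \<and> h < y"
    using sec params unfolding shift_values add_Pair mem_sector defs by ((intro conjI)?; linarith)
  have "x' = x - (2 * m + 2 * h + 1) \<and> y' = y \<or> x' = x \<and> y' = y - (2 * m + 2 * h + 1)"
    using j b zb sq params unfolding shift_values add_Pair jump_def defs fst_conv snd_conv by (smt (verit))
  then show ?thesis
  proof (elim disjE)
    assume e: "x' = x - (2 * m + 2 * h + 1) \<and> y' = y"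
    show ?thesis
      by (rule squares_liftedI [OF S, of _ _ _ 4], use e in \<open>simp add: shift_def Let_def\<close>,
          unfold mem_sector defs, intro conjI; use e zb sq b params in linarith)
  next
    assume e: "x' = x \<and> y' = y - (2 * m + 2 * h + 1)"
    show ?thesis
      by (rule squares_liftedI [OF S, of _ _ _ 6], use e in \<open>simp add: shift_def Let_def\<close>,
          unfold mem_sector defs, intro conjI; use e zb sq b params in linarith)
  qed
qed

lemma lifted_closed_G_E:
  assumes S: "(x, y) \<in> squares a"
    and sec: "(x, y) + shift G m h 0 \<in> sector (lift_m G m h) (lift_h G m h) 0"
    and j: "jump (lift_m G m h) (lift_m G m h + 2 * lift_h G m h + 1) ((x, y) + shift G m h 0) (x', y')"
    and b: "\<bar>x'\<bar> \<le> lift_m G m h + lift_h G m h" "\<bar>y'\<bar> \<le> lift_m G m h + lift_h G m h"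
  shows "(x', y') \<in> squares (lifted G m h a)"
proof -
  note defs = lift_m_def lift_h_def lift_type.case
  have sq: "\<bar>x\<bar> \<le> m + h" "\<bar>y\<bar> \<le> m + h"
    using S params by (cases rule: squares_cases; simp)+
  have zb: "- h \<le> x \<and> \<bar>y\<bar> \<le> h"
    using sec params unfolding shift_values add_Pair mem_sector defs by ((intro conjI)?; linarith)
  have "x' = x - (m + 2 * h + 1) \<and> y' = y + (m + 2 * h + 1) \<or> x' = x - (m + 2 * h + 1) \<and> y' = y - (m + 2 * h + 1)"
    using j b zb sq params unfolding shift_values add_Pair jump_def defs fst_conv snd_conv by (smt (verit))
  then show ?thesis
  proof (elim disjE)
    assume e: "x' = x - (m + 2 * h + 1) \<and> y' = y + (m + 2 * h + 1)"
    show ?thesis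
      by (rule squares_liftedI [OF S, of _ _ _ 3], use e in \<open>simp add: shift_def Let_def\<close>,
          unfold mem_sector defs, intro conjI; use e zb sq b params in linarith)
  next
    assume e: "x' = x - (m + 2 * h + 1) \<and> y' = y - (m + 2 * h + 1)"
    show ?thesis
      by (rule squares_liftedI [OF S, of _ _ _ 5], use e in \<open>simp add: shift_def Let_def\<close>,
          unfold mem_sector defs, intro conjI; use e zb sq b params in linarith)
  qed
qed

lemma lifted_closed_G_NE:
  assumes S: "(x, y) \<in> squares a"
    and sec: "(x, y) + shift G m h (Suc 0) \<in> sector (lift_m G m h) (lift_h G m h) (Suc 0)"
    and j: "jump (lift_m G m h) (lift_m G m h + 2 * lift_h G m h + 1) ((x, y) + shift G m h (Suc 0)) (x', y')"
    and b: "\<bar>x'\<bar> \<le> lift_m G m h + lift_h G m h" "\<bar>y'\<bar> \<le> lift_m G m h + lift_h G m h"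
  shows "(x', y') \<in> squares (lifted G m h a)"
proof -
  note defs = lift_m_def lift_h_def lift_type.case
  have sq: "\<bar>x\<bar> \<le> m + h" "\<bar>y\<bar> \<le> m + h"
    using S params by (cases rule: squares_cases; simp)+
  have zb: "x \<le> h \<and> y \<le> h"
    using sec params unfolding shift_values add_Pair mem_sector defs by ((intro conjI)?; linarith)
  have "x' = x - (2 * h + 1) \<and> y' = y \<or> x' = x \<and> y' = y - (2 * h + 1)"
    using j b zb sq params unfolding shift_values add_Pair jump_def defs fst_conv snd_conv by (smt (verit))
  then show ?thesis
  proof (elim disjE)
    assume e: "x' = x - (2 * h + 1) \<and> y' = y"
    show ?thesis
    proof (cases "- h \<le> y")
      case True
      show ?thesis
        by (rule squares_liftedI [OF S, of _ _ _ 4], use e in \<open>simp add: shift_def Let_def\<close>,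
            unfold mem_sector defs, intro conjI; use e True zb sq b params in linarith)
    next
      case False
      show ?thesis
        by (rule squares_lifted_moveI [OF S, of _ _ "x + m" "y + (m + 2 * h + 1)" _ 5],
            use e in \<open>simp add: shift_def Let_def\<close>,
            unfold mem_sector defs, (intro conjI)?; use e False zb sq b params in linarith)
    qed
  next
    assume e: "x' = x \<and> y' = y - (2 * h + 1)"
    show ?thesis
    proof (cases "- h \<le> x")
      case True
      show ?thesis
        by (rule squares_liftedI [OF S, of _ _ _ 6], use e in \<open>simp add: shift_def Let_def\<close>,
            unfold mem_sector defs, intro conjI; use e True zb sq b params in linarith)
    next
      case False
      show ?thesis
        by (rule squares_lifted_moveI [OF S, of _ _ "x + (m + 2 * h + 1)" "y + m" _ 5],
            use e in \<open>simp add: shift_def Let_def\<close>,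
            unfold mem_sector defs, (intro conjI)?; use e False zb sq b params in linarith)
    qed
  qed
qed

lemma lifted_closed_H_E:
  assumes S: "(x, y) \<in> squares a"
    and sec: "(x, y) + shift H m h 0 \<in> sector (lift_m H m h) (lift_h H m h) 0"
    and j: "jump (lift_m H m h) (lift_m H m h + 2 * lift_h H m h + 1) ((x, y) + shift H m h 0) (x', y')"
    and b: "\<bar>x'\<bar> \<le> lift_m H m h + lift_h H m h" "\<bar>y'\<bar> \<le> lift_m H m h + lift_h H m h"
  shows "(x', y') \<in> squares (lifted H m h a)"
proof -
  note defs = lift_m_def lift_h_def lift_type.case
  have sq: "\<bar>x\<bar> \<le> m + h" "\<bar>y\<bar> \<le> m + h"
    using S params by (cases rule: squares_cases; simp)+
  have zb: "x \<le> h"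
    using sec params unfolding shift_values add_Pair mem_sector defs by ((intro conjI)?; linarith)
  have "x' = x - (m + 2 * h + 1) \<and> y' = y + (m + 2 * h + 1) \<or> x' = x - (m + 2 * h + 1) \<and> y' = y - (m + 2 * h + 1)"
    using j b zb sq params unfolding shift_values add_Pair jump_def defs fst_conv snd_conv by (smt (verit))
  then show ?thesis
  proof (elim disjE)
    assume e: "x' = x - (m + 2 * h + 1) \<and> y' = y + (m + 2 * h + 1)"
    show ?thesis
    proof (cases "- h \<le> y")
      case True
      show ?thesis
        by (rule squares_liftedI [OF S, of _ _ _ 3], use e in \<open>simp add: shift_def Let_def\<close>,
            unfold mem_sector defs, intro conjI; use e True zb sq b params in linarith)
    next
      case False
      show ?thesis
        by (rule squares_lifted_moveI [OF S, of _ _ "x + m" "y + (m + 2 * h + 1)" _ 4],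
            use e in \<open>simp add: shift_def Let_def\<close>,
            unfold mem_sector defs, (intro conjI)?; use e False zb sq b params in linarith)
    qed
  next
    assume e: "x' = x - (m + 2 * h + 1) \<and> y' = y - (m + 2 * h + 1)"
    show ?thesis
    proof (cases "y \<le> h")
      case True
      show ?thesis
        by (rule squares_liftedI [OF S, of _ _ _ 5], use e in \<open>simp add: shift_def Let_def\<close>,
            unfold mem_sector defs, intro conjI; use e True zb sq b params in linarith)
    next
      case False
      show ?thesis
        by (rule squares_lifted_moveI [OF S, of _ _ "x + m" "y - (m + 2 * h + 1)" _ 4],
            use e in \<open>simp add: shift_def Let_def\<close>,
            unfold mem_sector defs, (intro conjI)?; use e False zb sq b params in linarith)
    qed
  qed
qed

lemma lifted_closed_H_NE:
  assumes S: "(x, y) \<in> squares a"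
    and sec: "(x, y) + shift H m h (Suc 0) \<in> sector (lift_m H m h) (lift_h H m h) (Suc 0)"
    and j: "jump (lift_m H m h) (lift_m H m h + 2 * lift_h H m h + 1) ((x, y) + shift H m h (Suc 0)) (x', y')"
    and b: "\<bar>x'\<bar> \<le> lift_m H m h + lift_h H m h" "\<bar>y'\<bar> \<le> lift_m H m h + lift_h H m h"
  shows "(x', y') \<in> squares (lifted H m h a)"
proof -
  note defs = lift_m_def lift_h_def lift_type.case
  have sq: "\<bar>x\<bar> \<le> m + h" "\<bar>y\<bar> \<le> m + h"
    using S params by (cases rule: squares_cases; simp)+
  have zb: "- h \<le> x \<and> - h \<le> y"
    using sec params unfolding shift_values add_Pair mem_sector defs by ((intro conjI)?; linarith)
  have "x' = x - (2 * m + 2 * h + 1) \<and> y' = y \<or> x' = x \<and> y' = y - (2 * m + 2 * h + 1)"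
    using j b zb sq params unfolding shift_values add_Pair jump_def defs fst_conv snd_conv by (smt (verit))
  then show ?thesis
  proof (elim disjE)
    assume e: "x' = x - (2 * m + 2 * h + 1) \<and> y' = y"
    show ?thesis
      by (rule squares_liftedI [OF S, of _ _ _ 4], use e in \<open>simp add: shift_def Let_def\<close>,
          unfold mem_sector defs, intro conjI; use e zb sq b params in linarith)
  next
    assume e: "x' = x \<and> y' = y - (2 * m + 2 * h + 1)"
    show ?thesis
      by (rule squares_liftedI [OF S, of _ _ _ 6], use e in \<open>simp add: shift_def Let_def\<close>,
          unfold mem_sector defs, intro conjI; use e zb sq b params in linarith)
  qed
qed

lemma lifted_closed:
  assumes "z \<in> squares (lifted e m h a)" "jump (lift_m e m h) (lift_m e m h + 2 * lift_h e m h + 1) z w"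
    "\<bar>fst w\<bar> \<le> lift_m e m h + lift_h e m h" "\<bar>snd w\<bar> \<le> lift_m e m h + lift_h e m h"
  shows "w \<in> squares (lifted e m h a)"
proof -
  obtain i where i: "z \<in> set (lifted e m h a i)" using assms(1) by (auto simp: squares_def)
  show ?thesis using split_cycle_axioms i assms(2-)
  proof (induction a i arbitrary: z w rule: split_cycle_turn_induct)
    case (E b)
    then interpret B: split_cycle m h r s b by simp
    obtain x y where x: "z - shift e m h 0 = (x, y)" by force
    then have z: "z = (x, y) + shift e m h 0" by (simp add: algebra_simps)
    have "(x, y) \<in> squares b" "(x, y) + shift e m h 0 \<in> sector (lift_m e m h) (lift_h e m h) 0"
      using E(2) B.mem_set_lifted x z by auto
    then show ?case
      using E(3-) B.lifted_closed_F_E B.lifted_closed_G_E B.lifted_closed_H_E unfolding z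
      by (cases w; cases e) (simp_all only: fst_conv snd_conv)
  next
    case (NE b)
    then interpret B: split_cycle m h r s b by simp
    obtain x y where x: "z - shift e m h (Suc 0) = (x, y)" by force
    then have z: "z = (x, y) + shift e m h (Suc 0)" by (simp add: algebra_simps)
    have "(x, y) \<in> squares b" "(x, y) + shift e m h (Suc 0) \<in> sector (lift_m e m h) (lift_h e m h) (Suc 0)"
      using NE(2) B.mem_set_lifted x z by auto
    then show ?case
      using NE(3-) B.lifted_closed_F_NE B.lifted_closed_G_NE B.lifted_closed_H_NE unfolding z
      by (cases w; cases e) (simp_all only: fst_conv snd_conv)
  next
    case (turn b i)
    then interpret B: split_cycle m h r s b by simp
    have "turn_back w \<in> squares (lifted e m h (turned b))"
    proof (rule turn(2))
      show "turn_back z \<in> set (lifted e m h (turned b) i)"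
        using turn(3) unfolding B.lifted_turned by (auto simp: turned_def)
      show "jump (lift_m e m h) (lift_m e m h + 2 * lift_h e m h + 1) (turn_back z) (turn_back w)"
        using turn(4) by simp
    qed (use turn(5,6) in \<open>simp_all add: turn_back_def\<close>)
    then show ?case
      unfolding B.lifted_turned squares_turned [of "lifted e m h b", OF B.lifted_8]
      by (simp add: inj_image_mem_iff [OF inj_turn_back])
  qed
qed

text \<open>The induction step: all properties of a split cycle pass to its lift.\<close>

lemma lifted_split_cycle: "split_cycle (lift_m e m h) (lift_h e m h) r s (lifted e m h a)"
proof
  show "set (lifted e m h a i) \<subseteq> sector (lift_m e m h) (lift_h e m h) i" for i
    using mem_set_lifted by blast
qed (use params lifted_params lifted_8 lifted_path lifted_link lifted_apart lifted_diagonal lifted_closed lifted_spread in auto)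

end


section \<open>Shell cycles\<close>

text \<open>The eight squares of the shell cycle with center at the origin.\<close>

definition star :: "int \<Rightarrow> int \<Rightarrow> nat \<Rightarrow> square" where
  "star m h i = (let k = if even i then 2 * h + 1 else m in (k * fst (direction i), k * snd (direction i)))"

lemma quarter_turn_star: "quarter_turn (star m h i) = star m h (Suc (Suc i))"
  by (simp add: star_def Let_def direction_step quarter_turn_def)

lemma turn_back_star: "turn_back (star m h (Suc (Suc i))) = star m h i"
  by (simp add: quarter_turn_star [symmetric])

lemma star_8: "star m h (i + 8) = star m h i"
  by (simp add: star_def direction_8)

lemma star_values:
  "star m h 0 = (2 * h + 1, 0)" "star m h (Suc 0) = (m, m)" "star m h 2 = (0, 2 * h + 1)"
  "star m h 3 = (- m, m)" "star m h 4 = (- (2 * h + 1), 0)" "star m h 5 = (- m, - m)"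
  "star m h 6 = (0, - (2 * h + 1))"
  by (simp_all add: star_def Let_def)

text \<open>The translations that keep the star within the shell. Only one of the two bounds \<open>h\<close> and
  \<open>m - h - 1\<close> matters, according as \<open>n \<le> 2 m\<close> or not.\<close>

definition near :: "int \<Rightarrow> int \<Rightarrow> square \<Rightarrow> bool" where
  "near m h t \<longleftrightarrow> \<bar>fst t\<bar> \<le> h \<and> \<bar>snd t\<bar> \<le> h \<and> \<bar>fst t\<bar> < m - h \<and> \<bar>snd t\<bar> < m - h"

lemma near_turn_back [simp]: "near m h (turn_back t) \<longleftrightarrow> near m h t"
  by (auto simp: near_def turn_back_def)

lemma near_quarter_turn [simp]: "near m h (quarter_turn t) \<longleftrightarrow> near m h t"
  by (metis near_turn_back turn_back_quarter_turn(1))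

lemma star_in_sector: "near m h t \<Longrightarrow> star m h i + t \<in> sector m h i"
proof (induction i arbitrary: t rule: induct_nat_012)
  case (ge2 i)
  then show ?case by (simp add: mem_sector_step turn_back_add turn_back_star)
qed (auto simp: star_values near_def mem_sector plus_prod_def)

lemma sector_subset_board:
  assumes "0 \<le> h" "0 \<le> m"
  shows "z \<in> sector m h i \<Longrightarrow> \<bar>fst z\<bar> \<le> m + h \<and> \<bar>snd z\<bar> \<le> m + h"
proof (induction i arbitrary: z rule: induct_nat_012)
  case (ge2 i)
  from ge2(1) [of "turn_back z"] ge2(3) show ?case by (simp add: mem_sector_step turn_back_def)
qed (use assms in \<open>auto simp: mem_sector\<close>)

text \<open>The graph of the \<open>(m, n)\<close>-leaper over the board has no edges leaving a translated
  star.\<close>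

lemma star_neighbours:
  assumes "near m h t" "jump m (m + 2 * h + 1) (star m h i + t) w" "\<bar>fst w\<bar> \<le> m + h" "\<bar>snd w\<bar> \<le> m + h"
  shows "\<exists>j. w = star m h j + t"
  using assms
proof (induction i arbitrary: t w rule: induct_nat_012)
  case 0
  obtain x y u v where w: "w = (x, y)" and t: "t = (u, v)" by (metis surj_pair)
  have "x = u - m \<and> (y = v + m \<or> y = v - m)"
    using 0 unfolding w t star_values jump_def near_def plus_prod_def fst_conv snd_conv
    by (smt (verit))
  then have "w = star m h 3 + t \<or> w = star m h 5 + t" by (auto simp: w t star_values)
  then show ?case by blast
next
  case 1
  obtain x y u v where w: "w = (x, y)" and t: "t = (u, v)" by (metis surj_pair)
  have "x = u - (2 * h + 1) \<and> y = v \<or> x = u \<and> y = v - (2 * h + 1)"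
    using 1 unfolding w t star_values jump_def near_def plus_prod_def fst_conv snd_conv
    by (smt (verit))
  then have "w = star m h 4 + t \<or> w = star m h 6 + t" by (auto simp: w t star_values)
  then show ?case by blast
next
  case (ge2 i)
  have "\<exists>j. turn_back w = star m h j + turn_back t"
  proof (rule ge2(1))
    show "jump m (m + 2 * h + 1) (star m h i + turn_back t) (turn_back w)"
      using ge2(4) by (metis jump_turn_back turn_back_add turn_back_star)
  qed (use ge2 in \<open>auto simp: turn_back_def near_def\<close>)
  then obtain j where "turn_back w = turn_back (star m h (Suc (Suc j)) + t)"
    by (auto simp: turn_back_add turn_back_star)
  then show ?case by auto
qed

lemma star_spots: "near m h t \<Longrightarrow> star m h i \<in> spots m h m i"
proof (induction i rule: induct_nat_012)
  case (ge2 i)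
  then show ?case by (simp add: spots_step turn_back_star)
qed (auto simp: star_values mem_spots near_def)

lemma star_jump: "jump \<bar>m - (2 * h + 1)\<bar> m (star m h i) (star m h (Suc i))" if "0 \<le> m" for i
proof (induction i rule: induct_nat_012)
  case (ge2 i)
  then show ?case by (metis jump_turn_back turn_back_star)
next
  case 1
  then show ?case using that star_values(3) [of m h] by (simp add: jump_def star_values numeral_2_eq_2 abs_minus_commute)
qed (use that in \<open>simp add: star_values jump_def\<close>)

lemma star_diagonal: "star m h (i + 3) - star m h i \<in>
    around {(- (m + 2 * h + 1), m)} {(- (m + 2 * h + 1), - m)} i"
proof (induction i rule: induct_nat_012)
  case (ge2 i)
  then show ?case
    using turn_back_star [of m h "i + 3"] by (simp add: mem_around turn_back_diff turn_back_star)
qed (simp_all add: star_values mem_around)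

text \<open>The base of the induction. The second leaper associated with a shell cycle of the
  \<open>(m, n)\<close>-frame has proportions \<open>\<bar>n - 2 m\<bar>\<close> and \<open>m\<close>.\<close>

lemma star_split_cycle:
  assumes "near m h t"
  shows "split_cycle m h \<bar>m - (2 * h + 1)\<bar> m (\<lambda>i. [star m h i + t])"
proof
  have h: "0 \<le> h" "h < m" using assms by (auto simp: near_def)
  show params: "0 \<le> h" "0 \<le> \<bar>m - (2 * h + 1)\<bar>" "\<bar>m - (2 * h + 1)\<bar> < m" "m \<le> m" "odd (\<bar>m - (2 * h + 1)\<bar> + m)"
    using h by auto
  fix i k :: nat and z w :: square
  show "[star m h (i + 8) + t] = [star m h i + t]" by (simp add: star_8)
  show "set [star m h i + t] \<subseteq> sector m h i" using star_in_sector [OF assms] by simp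
  show "induced_path \<bar>m - (2 * h + 1)\<bar> m [star m h i + t]"
    using h by (simp add: induced_path_def joined_def jump_def)
  show "linked \<bar>m - (2 * h + 1)\<bar> m [star m h i + t] [star m h (Suc i) + t]"
    using star_jump h by (simp add: linked_def)
  show "apart \<bar>m - (2 * h + 1)\<bar> m [star m h i + t] [star m h (i + k) + t]" if "k \<in> {2, 3, 4}"
    \<comment> \<open>The star itself occupies spots, with the diagonal squares of the second kind.\<close>
    using spots_no_jump [OF params(5,2,3,4,1) that star_spots [OF assms] star_spots [OF assms]]
    by (simp add: apart_def)
  show "hd [star m h (i + 3) + t] - last [star m h i + t] \<in>
      around {(- (m + 2 * h + 1), m)} {(- (m + 2 * h + 1), - m)} i"
    using star_diagonal by simp
  show "w \<in> squares (\<lambda>i. [star m h i + t])"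
    if zS: "z \<in> squares (\<lambda>i. [star m h i + t])" and near: "jump m (m + 2 * h + 1) z w"
      "\<bar>fst w\<bar> \<le> m + h" "\<bar>snd w\<bar> \<le> m + h"
  proof -
    obtain j where "z = star m h j + t" using zS by (auto simp: squares_def)
    then show ?thesis using star_neighbours [OF assms, of j w] that by (auto simp: squares_def)
  qed
  show "m \<le> 2 * h + 1 \<or> (\<exists>u. \<forall>i. \<forall>z\<in>set [star m h i + t]. z - u \<in> spots m h m i)"
    using star_spots [OF assms] by (intro disjI2 exI [of _ t]) simp
qed

lemma shell_near:
  assumes n: "int n = int m + 2 * h + 1" and "n < 3 * m" "0 \<le> h" and z: "z \<in> shell (m, n)"
  shows "\<exists>i t. near (int m) h t \<and> z = star (int m) h i + t"
proof -
  have turn: "\<exists>i t. near (int m) h t \<and> (quarter_turn ^^ k) w = star (int m) h i + t"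
    if "near (int m) h t" "w = star (int m) h i + t" for w i t k
  proof (induction k)
    case 0
    then show ?case using that by (intro exI [of _ i] exI [of _ t]) simp
  next
    case (Suc k)
    then obtain i t where "near (int m) h t" "(quarter_turn ^^ k) w = star (int m) h i + t" by blast
    moreover have "quarter_turn (v + u) = quarter_turn v + quarter_turn u" for v u
      by (simp add: quarter_turn_def prod_eq_iff)
    ultimately show ?case
      by (intro exI [of _ "Suc (Suc i)"] exI [of _ "quarter_turn t"]) (simp add: quarter_turn_star)
  qed
  have E: "\<exists>i t. near (int m) h t \<and> (x, y) = star (int m) h i + t" if "near (int m) h (x - (2 * h + 1), y)" for x y
    using that by (intro exI [of _ 0] exI) (auto simp: star_values prod_eq_iff)
  have NE: "\<exists>i t. near (int m) h t \<and> (x, y) = star (int m) h i + t" if "near (int m) h (x - int m, y - int m)" for x y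
    using that by (intro exI [of _ "Suc 0"] exI) (auto simp: star_values prod_eq_iff)
  from z obtain k w where k: "z = (quarter_turn ^^ k) w"
    and w: "w \<in> (if n \<le> 2 * m
      then {(x, y). 3 * int m - int n < 2 * x \<and> 2 * x < int m + int n \<and>
                    3 * int m - int n < 2 * y \<and> 2 * y < int m + int n}
         \<union> {(x, y). int n - int m < 2 * x \<and> 2 * x < 3 * (int n - int m) \<and>
                    2 * \<bar>y\<bar> < int n - int m}
      else {(x, y). 3 * int n - 5 * int m < 2 * x \<and> 2 * x < int m + int n \<and>
                    2 * \<bar>y\<bar> < 3 * int m - int n}
         \<union> {(x, y). int n - int m < 2 * x \<and> 2 * x < 5 * int m - int n \<and>
                    int n - int m < 2 * y \<and> 2 * y < 5 * int m - int n})"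
    unfolding shell.simps by blast
  obtain x y where xy: "w = (x, y)" by force
  have "near (int m) h (x - (2 * h + 1), y) \<or> near (int m) h (x - int m, y - int m)"
    using w assms unfolding near_def xy by (auto split: if_splits)
  then show ?thesis using turn E NE unfolding k xy by metis
qed


section \<open>From split cycles to leaper graphs\<close>

context split_cycle
begin

text \<open>All pairs of directions that are not adjacent.\<close>

lemma apart_wide:
  assumes "j + 2 \<le> i" "i \<le> j + 6"
  shows "apart r s (a j) (a i)"
proof (cases "i \<le> j + 4")
  case True
  then have "i - j = 2 \<or> i - j = 3 \<or> i - j = 4" using assms by arith
  then show ?thesis using nonadjacent [of "i - j" j] assms by simp
next
  case False
  then have "j + 8 - i = 2 \<or> j + 8 - i = 3" using assms by arith
  then have "apart r s (a i) (a j)"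
    using nonadjacent [of "j + 8 - i" i] assms periodic [of j] by auto
  then show ?thesis by (rule apart_sym)
qed

lemma induced_path_arc:
  "k \<le> 6 \<Longrightarrow> induced_path r s (concat (map a [0..<Suc k]))"
proof (induction k)
  case 0
  then show ?case using path [of 0] by simp
next
  case (Suc k)
  have "apart r s (a j) (a (Suc k))" if "j < k" for j using apart_wide that Suc.prems by simp
  then have "apart r s (concat (map a [0..<k])) (a (Suc k))" by (force simp: apart_def)
  then have "linked r s (concat (map a [0..<k]) @ a k) (a (Suc k))"
    using link by (intro linked_append1) simp_all
  then have "induced_path r s (concat (map a [0..<Suc k]) @ a (Suc k))"
    using Suc path by (intro induced_path_append) simp_all
  then show ?case by simp
qed

lemma squares_less_8: "squares a = (\<Union>i<8. set (a i))"
proof -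
  have "set (a i) \<subseteq> (\<Union>i<8. set (a i))" for i
    using a_mod_8 [of i] by (metis UN_upper lessThan_iff mod_less_divisor zero_less_numeral)
  then show ?thesis by (auto simp: squares_def)
qed

text \<open>The first seven pieces form an induced path, and the eighth one is joined to it at both
  ends.\<close>

lemma jump_iff_cyclically_joined:
  defines "c \<equiv> concat (map a [0..<8])"
  assumes "z \<in> set c" "w \<in> set c"
  shows "jump r s z w \<longleftrightarrow> joined c z w \<or> {z, w} = {hd c, last c}"
proof -
  define b where "b = concat (map a [Suc 0..<7])"
  have up: "[0..<7] = 0 # [Suc 0..<7]" "[Suc 0..<7] = [Suc 0..<6] @ [6]"
    using upt_conv_Cons [of 0 7] upt_Suc_append [of "Suc 0" 6] by simp_all
  have c: "c = (a 0 @ b) @ a 7"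
    using upt_Suc_append [of 0 7] by (simp add: c_def b_def up(1))
  have P: "induced_path r s (a 0 @ b)"
    using induced_path_arc [of 6] up(1) by (simp add: b_def)
  have b: "b = concat (map a [Suc 0..<6]) @ a 6" by (simp add: b_def up(2))
  have "apart r s (a j) (a 7)" if "j \<in> {Suc 0..<6}" for j using apart_wide that by simp
  then have "apart r s (concat (map a [Suc 0..<6])) (a 7)" by (force simp: apart_def)
  then have L: "linked r s b (a 7)"
    using link [of 6] unfolding b by (intro linked_append1) simp_all
  have ends: "hd c = hd (a 0)" "last c = last (a 7)" "last (a 0 @ b) = last b" "b \<noteq> []"
    using nonempty by (simp_all add: c b)
  have W: "jump r s z w \<longleftrightarrow> z = last (a 7) \<and> w = hd (a 0)" if "z \<in> set (a 7)" "w \<in> set (a 0)" for z w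
    using wrapped(4) that by (simp add: linked_def)
  have Wj: "jump r s (last (a 7)) (hd (a 0))" using W by simp
  have bl: "jump r s z w \<longleftrightarrow> z = last b \<and> w = hd (a 7)" if "z \<in> set b" "w \<in> set (a 7)" for z w
    using L that by (simp add: linked_def)
  have blj: "jump r s (last b) (hd (a 7))" using bl ends(4) by simp
  have ab: "jump r s z w \<longleftrightarrow> joined (a 0 @ b) z w" if "z \<in> set (a 0 @ b)" "w \<in> set (a 0 @ b)" for z w
    using P that by (simp add: induced_path_def)
  have a7: "jump r s z w \<longleftrightarrow> joined (a 7) z w" if "z \<in> set (a 7)" "w \<in> set (a 7)" for z w
    using path [of 7] that by (simp add: induced_path_def)
  have j: "joined c z w \<longleftrightarrow> joined (a 0 @ b) z w \<or> joined (a 7) z w \<or> {z, w} = {last b, hd (a 7)}"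
    unfolding c joined_def using consecutive_append [of "a 0 @ b" "a 7"] ends by (auto simp: doubleton_eq_iff)
  have sub: "joined zs z w \<Longrightarrow> z \<in> set zs \<and> w \<in> set zs" for zs :: "square list" and z w
    using consecutive_subset by (fastforce simp: joined_def)
  show ?thesis
  proof
    assume "jump r s z w"
    moreover from this have "jump r s w z" by (simp add: jump_sym)
    ultimately show "joined c z w \<or> {z, w} = {hd c, last c}"
      using assms(2,3) ab [of z w] a7 [of z w] W [of z w] W [of w z] bl [of z w] bl [of w z]
      unfolding j ends unfolding c set_append Un_iff doubleton_eq_iff by blast
  next
    assume "joined c z w \<or> {z, w} = {hd c, last c}"
    then show "jump r s z w"
      unfolding j ends
      using Wj blj Wj [unfolded jump_sym [of r s "last (a 7)"]] blj [unfolded jump_sym [of r s "last b"]]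
        ab [of z w] a7 [of z w] sub [of "a 0 @ b" z w] sub [of "a 7" z w]
      unfolding doubleton_eq_iff by blast
  qed
qed

end

lemma cycle_graph_consecutive:
  assumes "c \<noteq> []"
  shows "snd (cycle_graph c) = {{z, w} | z w. joined c z w \<or> {z, w} = {hd c, last c}}"
proof -
  have edge: "{c ! i, c ! (Suc i mod length c)} \<in> {{z, w} | z w. joined c z w \<or> {z, w} = {hd c, last c}}"
    if "i < length c" for i
  proof (cases "Suc i < length c")
    case True
    then have "joined c (c ! i) (c ! Suc i)" by (auto simp: joined_def consecutive_nth)
    with True show ?thesis by (simp only: mod_less) blast
  next
    case False
    then have "Suc i = length c" using that by simp
    then have "i = length c - 1" "Suc i mod length c = 0" by simp_all
    then have "{c ! i, c ! (Suc i mod length c)} = {hd c, last c}"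
      using assms by (simp add: last_conv_nth hd_conv_nth insert_commute)
    then show ?thesis by blast
  qed
  have ordered: "\<exists>i<length c. {z, w} = {c ! i, c ! (Suc i mod length c)}" if zw: "(z, w) \<in> consecutive c" for z w
  proof -
    obtain i where "Suc i < length c" "z = c ! i" "w = c ! Suc i"
      using zw by (auto simp: consecutive_nth)
    then show ?thesis by (intro exI [of _ i]) simp
  qed
  have cons: "\<exists>i<length c. {z, w} = {c ! i, c ! (Suc i mod length c)}" if "joined c z w" for z w
    using that ordered [of z w] ordered [of w z] unfolding joined_def insert_commute [of w z] by blast
  have wrap: "\<exists>i<length c. {hd c, last c} = {c ! i, c ! (Suc i mod length c)}"
    using assms by (intro exI [of _ "length c - 1"]) (simp add: last_conv_nth hd_conv_nth insert_commute)
  show ?thesis unfolding cycle_graph_def snd_conv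
  proof (intro equalityI subsetI)
    fix e assume "e \<in> {{c ! i, c ! (Suc i mod length c)} | i. i < length c}"
    then show "e \<in> {{z, w} | z w. joined c z w \<or> {z, w} = {hd c, last c}}" using edge by blast
  next
    fix e assume "e \<in> {{z, w} | z w. joined c z w \<or> {z, w} = {hd c, last c}}"
    then obtain z w where "e = {z, w}" "joined c z w \<or> {z, w} = {hd c, last c}" by blast
    then have "\<exists>i<length c. e = {c ! i, c ! (Suc i mod length c)}" using cons wrap by metis
    then show "e \<in> {{c ! i, c ! (Suc i mod length c)} | i. i < length c}" by blast
  qed
qed

lemma (in split_cycle) cycle_graph_eq_leaper_graph:
  assumes "\<And>z w. leaper_move M z w \<longleftrightarrow> jump r s z w"
  shows "cycle_graph (concat (map a [0..<8])) = leaper_graph M (squares a)"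
proof -
  define c where "c = concat (map a [0..<8])"
  have set: "set c = squares a" by (auto simp: c_def squares_less_8)
  have "c \<noteq> []" if "c = a 0 @ xs" for xs using that by simp
  then have ne: "c \<noteq> []" by (simp add: c_def upt_conv_Cons)
  have sub: "joined c z w \<Longrightarrow> z \<in> set c \<and> w \<in> set c" for z w
    using consecutive_subset by (fastforce simp: joined_def)
  have ends: "{z, w} = {hd c, last c} \<Longrightarrow> z \<in> set c \<and> w \<in> set c" for z w
    using ne by (metis insertI1 insertI2 hd_in_set last_in_set insertE singletonD)
  have "(joined c z w \<or> {z, w} = {hd c, last c}) \<longleftrightarrow>
      z \<in> squares a \<and> w \<in> squares a \<and> jump r s z w" for z w
    using jump_iff_cyclically_joined [folded c_def, of z w] sub [of z w] ends [of z w]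
    unfolding set by blast
  then show ?thesis
    using cycle_graph_consecutive [OF ne] set
    unfolding leaper_graph_def assms c_def [symmetric] by (simp add: cycle_graph_def prod_eq_iff)
qed


section \<open>The canonical second leaper cycle\<close>

lemma frame_section_eq_sector:
  assumes "int n = int m + 2 * h + 1"
  shows "frame_section (m, n) i = sector (int m) h i"
proof -
  have "{(x, y). int n - int m < 2 * x \<and> 2 * x < int m + int n \<and> 2 * \<bar>y\<bar> < int n - int m} =
      {(x, y). h < x \<and> x \<le> int m + h \<and> - h \<le> y \<and> y \<le> h}"
    "{(x, y). int n - int m < 2 * x \<and> 2 * x < int m + int n \<and>
              int n - int m < 2 * y \<and> 2 * y < int m + int n} =
      {(x, y). h < x \<and> x \<le> int m + h \<and> h < y \<and> y \<le> int m + h}"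
    using assms by auto
  then show ?thesis by (simp add: sector_def around_def)
qed

lemma lift_vector_eq_shift:
  "int n = int m + 2 * h + 1 \<Longrightarrow> lift_vector e (m, n) i = shift e (int m) h i"
  by (cases e) (simp_all add: shift_def Let_def)

lemma lift_leaper_params:
  assumes "int n = int m + 2 * h + 1" "0 \<le> h" "lift_leaper e (m, n) = (m', n')"
  shows "int m' = lift_m e (int m) h" "int n' = int m' + 2 * lift_h e (int m) h + 1"
proof -
  have "m \<le> 2 * n" using assms(1,2) by linarith
  then show "int m' = lift_m e (int m) h" "int n' = int m' + 2 * lift_h e (int m) h + 1"
    using assms by (cases e; auto simp: lift_m_def lift_h_def of_nat_diff)+
qed

text \<open>Since indices are reduced modulo 8, only the values on \<open>{0, \<dots>, 7}\<close> matter.\<close>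

lemma lift_pieces_cong:
  assumes "\<And>i. i < 8 \<Longrightarrow> a i = b i" "i < 8"
  shows "lift_pieces e a i = lift_pieces e b i"
  using assms by (cases e) simp_all

text \<open>Along any string of lifts, the set and the paths produced from a split cycle are again
  those of a split cycle.\<close>

lemma lift_along:
  assumes "split_cycle (int m) h r s a" "int n = int m + 2 * h + 1"
    and "\<And>i. i < 8 \<Longrightarrow> c i = a i"
  shows "\<exists>m' n' h' b. foldr lift_leaper ds (m, n) = (m', n') \<and> int n' = int m' + 2 * h' + 1 \<and>
    split_cycle (int m') h' r s b \<and> lift_set_along ds (m, n) (squares a) = squares b \<and>
    (\<forall>i<8. lift_paths_along ds (m, n) c i = b i)"
proof (induction ds)
  case Nil
  then show ?case using assms by auto
next
  case (Cons e ds)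
  then obtain m' n' h' b where IH: "foldr lift_leaper ds (m, n) = (m', n')" "int n' = int m' + 2 * h' + 1"
    "split_cycle (int m') h' r s b" "lift_set_along ds (m, n) (squares a) = squares b"
    "\<And>i. i < 8 \<Longrightarrow> lift_paths_along ds (m, n) c i = b i" by blast
  interpret B: split_cycle "int m'" h' r s b by (rule IH)
  obtain m2 n2 where L: "lift_leaper e (m', n') = (m2, n2)" by force
  note p = lift_leaper_params [OF IH(2) B.params(1) L]
  have sc: "split_cycle (int m2) (lift_h e (int m') h') r s (lifted e (int m') h' b)"
    using B.lifted_split_cycle [of e] p by simp
  have "lift_set e (m', n') (squares b) = squares (lifted e (int m') h' b)"
  proof -
    have "(\<lambda>z. z + v) ` S \<inter> T = {z \<in> T. z - v \<in> S}" for v :: square and S T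
      by (force simp: image_iff)
    moreover have "set (lifted e (int m') h' b i) =
        {z \<in> sector (int m2) (lift_h e (int m') h') i. z - shift e (int m') h' i \<in> squares b}" for i
      by (rule set_eqI) (simp add: B.mem_set_lifted p(1))
    ultimately show ?thesis
      unfolding lift_set_def split_cycle.squares_less_8 [OF sc] L lift_vector_eq_shift [OF IH(2)]
        frame_section_eq_sector [OF p(2)] by simp
  qed
  moreover have "lift_paths e (m', n') (lift_paths_along ds (m, n) c) i = lifted e (int m') h' b i"
    if "i < 8" for i
    unfolding lift_paths_def lifted_def lift_vector_eq_shift [OF IH(2)]
    using lift_pieces_cong [OF IH(5) that] by simp
  ultimately show ?case using IH(1,4) L p(2) sc
    by (intro exI [of _ m2] exI [of _ n2] exI [of _ "lift_h e (int m') h'"] exI) auto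
qed

lemma leaper_of_descent_params:
  obtains h where "int (snd (leaper_of_descent es)) = int (fst (leaper_of_descent es)) + 2 * h + 1" "0 \<le> h"
    "0 < fst (leaper_of_descent es)"
proof -
  have "\<exists>h. int (snd (leaper_of_descent es)) = int (fst (leaper_of_descent es)) + 2 * h + 1 \<and> 0 \<le> h \<and>
    0 < fst (leaper_of_descent es)"
  proof (induction es)
    case Nil
    then show ?case by (simp add: leaper_of_descent_def)
  next
    case (Cons e es)
    then obtain m n h where mn: "leaper_of_descent es = (m, n)" "int n = int m + 2 * h + 1" "0 \<le> h" "0 < m"
      by (metis prod.collapse)
    obtain m' n' where L: "lift_leaper e (m, n) = (m', n')" by force
    have "leaper_of_descent (e # es) = (m', n')" using mn(1) L by (simp add: leaper_of_descent_def)
    moreover have "0 \<le> lift_h e (int m) h" "0 < lift_m e (int m) h"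
      using mn by (cases e; simp add: lift_h_def lift_m_def)+
    ultimately show ?case using lift_leaper_params [OF mn(2,3) L] by auto
  qed
  then show thesis using that by blast
qed

text \<open>Starting from one square of the shell cycle, its consecutive squares never leave a
  translated star, and the star has only eight squares.\<close>

lemma shell_cycle_star:
  assumes n: "int n = int m + 2 * h + 1" and "n < 3 * m" "0 \<le> h" and c: "shell_cycle (m, n) c"
  obtains t where "near (int m) h t" "set c = squares (\<lambda>i. [star (int m) h i + t])"
proof -
  have c8: "length c = 8" "distinct c" "set c \<subseteq> shell (m, n)"
    and edges: "snd (cycle_graph c) \<subseteq> snd (leaper_graph (m, n) (shell (m, n)))"
    using c by (auto simp: shell_cycle_def leaper_cycle_def)
  have "c ! 0 \<in> shell (m, n)" using c8 by (metis nth_mem subsetD zero_less_numeral)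
  then obtain i t where t: "near (int m) h t" "c ! 0 = star (int m) h i + t"
    using shell_near [OF assms(1-3)] by blast
  have mem: "\<exists>j. c ! k = star (int m) h j + t" if "k < 8" for k
    using that
  proof (induction k)
    case (Suc k)
    then obtain j where j: "c ! k = star (int m) h j + t" by auto
    have "{c ! k, c ! Suc k} \<in> snd (leaper_graph (m, n) (shell (m, n)))"
      using edges Suc.prems c8(1) by (force simp: cycle_graph_def)
    then have "leaper_move (m, n) (c ! k) (c ! Suc k) \<or> leaper_move (m, n) (c ! Suc k) (c ! k)"
      by (auto simp: leaper_graph_def doubleton_eq_iff)
    then have "jump (int m) (int n) (c ! k) (c ! Suc k)"
      by (auto simp: leaper_move_jump jump_sym)
    moreover obtain l u where "c ! Suc k = star (int m) h l + u" "near (int m) h u"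
      using shell_near [OF assms(1-3), of "c ! Suc k"] Suc.prems c8 by (metis nth_mem subsetD)
    then have "\<bar>fst (c ! Suc k)\<bar> \<le> int m + h" "\<bar>snd (c ! Suc k)\<bar> \<le> int m + h"
      using sector_subset_board [OF assms(3) _ star_in_sector, of "int m" u] by auto
    ultimately show ?case using star_neighbours [OF t(1)] unfolding j n by blast
  qed (use t in auto)
  interpret split_cycle "int m" h "\<bar>int m - (2 * h + 1)\<bar>" "int m" "\<lambda>i. [star (int m) h i + t]"
    by (rule star_split_cycle [OF t(1)])
  have "set c \<subseteq> squares (\<lambda>i. [star (int m) h i + t])"
  proof
    fix z assume "z \<in> set c"
    then obtain k where "k < 8" "z = c ! k" using c8(1) by (auto simp: in_set_conv_nth)
    then show "z \<in> squares (\<lambda>i. [star (int m) h i + t])" using mem [of k] by (auto simp: squares_def)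
  qed
  moreover have "squares (\<lambda>i. [star (int m) h i + t]) = (\<lambda>i. star (int m) h i + t) ` {..<8}"
    by (auto simp: squares_less_8)
  moreover from this have "finite (squares (\<lambda>i. [star (int m) h i + t]))"
    "card (squares (\<lambda>i. [star (int m) h i + t])) \<le> 8"
    using card_image_le [of "{..<8::nat}" "\<lambda>i. star (int m) h i + t"] by simp_all
  ultimately have "set c = squares (\<lambda>i. [star (int m) h i + t])"
    using c8 distinct_card [of c] by (intro card_seteq) simp_all
  then show thesis using that t(1) by blast
qed

lemma sector_disjoint:
  assumes "z \<in> sector m h i" "z \<in> sector m h j" "i < 8" "j < 8" "0 \<le> h"
  shows "i = j"
proof -
  obtain x y where "z = (x, y)" by force
  show ?thesis
    using less_8_cases [OF assms(3)] less_8_cases [OF assms(4)] assms(1,2,5) unfolding \<open>z = (x, y)\<close>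
    by (elim disjE; simp add: mem_sector)
qed

text \<open>The first character of the descent, if any, is \<open>G\<close> or \<open>H\<close>, and undoing this one lift gives
  the second leaper.\<close>

lemma second_leaper_jump:
  assumes es: "leaper_of_descent es = (m, n)" "int n = int m + 2 * h + 1" "n \<le> 3 * m" "0 \<le> h"
    and M: "M = (case es of [] \<Rightarrow> (0, 1) | e # es' \<Rightarrow> leaper_of_descent es')"
  shows "leaper_move M z w \<longleftrightarrow> jump \<bar>int m - (2 * h + 1)\<bar> (int m) z w"
proof (cases es)
  case Nil
  then have "m = 1" "h = 0" "M = (0, 1)" using es M by (auto simp: leaper_of_descent_def)
  then show ?thesis by (simp add: leaper_move_jump)
next
  case (Cons e es')
  obtain m0 n0 h0 where 0: "leaper_of_descent es' = (m0, n0)" "int n0 = int m0 + 2 * h0 + 1" "0 \<le> h0"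
    by (metis leaper_of_descent_params prod.collapse)
  then have L: "lift_leaper e (m0, n0) = (m, n)"
    using es(1) Cons by (simp add: leaper_of_descent_def)
  then have "e \<noteq> F" using es(3) 0 by auto
  then have "int n0 = int m" "int m0 = \<bar>int m - (2 * h + 1)\<bar>"
    using L 0 es(2) by (cases e; auto simp: of_nat_diff)+
  then show ?thesis using 0(1) M Cons by (simp add: leaper_move_jump)
qed

lemma canonical_second_basic_graph:
  assumes "canonical_second_basic L C M D"
  shows "cycle_graph D = leaper_graph M (set C)"
proof -
  obtain ds es C' s where shell: "shell_cycle (leaper_of_descent es) C'"
    and C: "set C = lift_set_along ds (leaper_of_descent es) (set C')"
    and M: "M = (case es of [] \<Rightarrow> (0, 1) | e # es' \<Rightarrow> leaper_of_descent es')"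
    and s: "\<And>i. i < 8 \<Longrightarrow> s i \<in> set C' \<inter> frame_section (leaper_of_descent es) i"
    and D: "D = concat (map (lift_paths_along ds (leaper_of_descent es) (\<lambda>i. [s i])) [0..<8])"
    using assms unfolding canonical_second_basic_def by blast
  obtain m n h where mn: "leaper_of_descent es = (m, n)" "int n = int m + 2 * h + 1" "0 \<le> h" "0 < m"
    by (metis leaper_of_descent_params prod.collapse)
  have "n \<le> 3 * m" using shell mn(1) by (simp add: shell_cycle_def)
  \<comment> \<open>\<open>m + n\<close> is odd.\<close>
  moreover have "n \<noteq> 3 * m" using mn(2) by presburger
  ultimately have n: "n < 3 * m" by simp
  obtain t where t: "near (int m) h t" "set C' = squares (\<lambda>i. [star (int m) h i + t])"
    using shell_cycle_star [OF mn(2) n mn(3)] shell mn(1) by metis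
  define a where "a = (\<lambda>i. [star (int m) h i + t])"
  define r where "r = \<bar>int m - (2 * h + 1)\<bar>"
  interpret A: split_cycle "int m" h r "int m" a
    unfolding a_def r_def by (rule star_split_cycle [OF t(1)])
  have C': "set C' = squares a" using t(2) by (simp add: a_def)
  have "[s i] = a i" if "i < 8" for i
  proof -
    have "s i \<in> sector (int m) h i" "s i \<in> squares a"
      using s [OF that] C' by (simp_all add: mn(1) frame_section_eq_sector [OF mn(2)] del: frame_section.simps)
    moreover from this obtain j where "j < 8" "s i \<in> set (a j)" "s i \<in> sector (int m) h j"
      using A.squares_sector by blast
    ultimately show ?thesis using sector_disjoint that mn(3) by (metis a_def empty_iff empty_set set_ConsD)
  qed
  then obtain m' n' h' b where b: "split_cycle (int m') h' r (int m) b"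
    "lift_set_along ds (m, n) (squares a) = squares b"
    "\<And>i. i < 8 \<Longrightarrow> lift_paths_along ds (m, n) (\<lambda>i. [s i]) i = b i"
    using lift_along [OF A.split_cycle_axioms mn(2), of "\<lambda>i. [s i]" ds] by blast
  have "D = concat (map b [0..<8])" unfolding D mn(1) using b(3) by (intro arg_cong [of _ _ concat]) simp
  moreover have "set C = squares b" using C C' b(2) mn(1) by simp
  moreover have "leaper_move M z w \<longleftrightarrow> jump r (int m) z w" for z w
    unfolding r_def by (rule second_leaper_jump [OF mn(1,2) _ mn(3) M]) (use n in simp)
  ultimately show ?thesis using split_cycle.cycle_graph_eq_leaper_graph [OF b(1)] by simp
qed

lemma cycle_graph_map:
  "cycle_graph (map f c) = (f ` fst (cycle_graph c), (`) f ` snd (cycle_graph c))"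
proof -
  have "{map f c ! i, map f c ! (Suc i mod length c)} = f ` {c ! i, c ! (Suc i mod length c)}"
    if "i < length c" for i
  proof -
    have "Suc i mod length c < length c" using that by (intro mod_less_divisor) auto
    then show ?thesis using that by simp
  qed
  then have "{{map f c ! i, map f c ! (Suc i mod length c)} | i. i < length c} =
      (`) f ` {{c ! i, c ! (Suc i mod length c)} | i. i < length c}"
    unfolding setcompr_eq_image image_image by (intro image_cong) simp_all
  then show ?thesis by (simp add: cycle_graph_def)
qed

lemma leaper_graph_image:
  assumes "\<And>z w. leaper_move M' (f z) (f w) \<longleftrightarrow> leaper_move M z w"
  shows "leaper_graph M' (f ` B) = (f ` fst (leaper_graph M B), (`) f ` snd (leaper_graph M B))"
proof -
  have "{{a, b} | a b. a \<in> f ` B \<and> b \<in> f ` B \<and> leaper_move M' a b} =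
      (`) f ` {{a, b} | a b. a \<in> B \<and> b \<in> B \<and> leaper_move M a b}" (is "?l = ?r")
  proof (intro equalityI subsetI)
    fix e assume "e \<in> ?l"
    then obtain a b where "e = f ` {a, b}" "a \<in> B" "b \<in> B" "leaper_move M a b"
      using assms by auto
    then show "e \<in> ?r" by blast
  next
    fix e assume "e \<in> ?r"
    then obtain a b where "e = {f a, f b}" "a \<in> B" "b \<in> B" "leaper_move M' (f a) (f b)"
      using assms by auto
    then show "e \<in> ?l" by blast
  qed
  then show ?thesis by (simp add: leaper_graph_def)
qed

lemma leaper_move_scaled_copy:
  assumes "0 < d"
  shows "leaper_move (d * fst M, d * snd M) (scaled_copy d t z) (scaled_copy d t w) \<longleftrightarrow> leaper_move M z w"
proof -
  have "\<bar>int d * x - int d * y\<bar> = int (d * k) \<longleftrightarrow> \<bar>x - y\<bar> = int k" for x y k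
  proof -
    have "\<bar>int d * x - int d * y\<bar> = int d * \<bar>x - y\<bar>"
      by (simp add: abs_mult flip: right_diff_distrib)
    then show ?thesis using assms by simp
  qed
  then show ?thesis by (simp add: leaper_move_def scaled_copy_def)
qed

theorem theorem13:
  fixes p q :: nat and z :: square and C D :: "square list" and M :: leaper
  assumes "odd (p + q)"
    and "leaper_cycle (p, q) (board z (p + q)) C"
    and "canonical_second (p, q) C M D"
  shows "cycle_graph D = leaper_graph M (set C)"
proof -
  define d where "d = gcd p q"
  have d: "0 < d" using assms(1) by (auto simp: d_def intro: gcd_pos_nat)
  obtain t C0 M0 D0 L0 where C: "C = map (scaled_copy d t) C0" and "canonical_second_basic L0 C0 M0 D0"
    and M: "M = (d * fst M0, d * snd M0)" and D: "D = map (scaled_copy d t) D0"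
    using assms(3) unfolding canonical_second_def Let_def d_def fst_conv snd_conv by blast
  then have "cycle_graph D0 = leaper_graph M0 (set C0)" by (intro canonical_second_basic_graph)
  then show ?thesis
    unfolding C D M set_map cycle_graph_map
      leaper_graph_image [of _ "scaled_copy d t" M0, OF leaper_move_scaled_copy [OF d]] by simp
qed

end
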